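(* Let $R$ be a commutative Noetherian ring, let $n\ge 0$ be an integer, and let $M,N$ be finitely generated $R$-modules with $\operatorname{Ext}_R^{i}(M,N)=0$ for all $1\le i\le n-1$. If $\operatorname{Hom}_R(M,N)$ is absolutely (resp., universally) $n$-residually faithful, then so is $N$.
   Context: For a finitely generated $R$-module $L$ and an integer $n\ge 1$: $L$ is absolutely $n$-residually faithful if for every $L$-regular sequence $\mathbf x=x_1,\dots,x_n$, the module $L/\mathbf xL$ is faithful over $R/\mathbf xR$. $L$ is universally $n$-residually faithful if for every sequence $\mathbf x=x_1,\dots,x_n$ regular on both $R$ and $L$, the module $L/\mathbf xL$ is faithful over $R/\mathbf xR$. For $n=0$, by convention, an absolutely (resp., universally) $0$-residually faithful $R$-module is just a faithful $R$-module.
   Formalization: An L-regular sequence is only required to have each x_i a nonzerodivisor on L/(x_1,…,x_{i-1})L; the condition xL ≠ L is not imposed, since with it the claim fails (M = 0, R = k[u,v], N = R/(u), n = 1, x = v). *)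

theory Defs
  imports "HOL-Algebra.Module" "HOL-Algebra.QuotRing" "HOL-Algebra.Ring_Divisibility"
begin

text \<open>A module over \<open>R\<close> is a record satisfying the library locale \<open>module R\<close>. That record type
  extends \<open>ring\<close>, so it has the fields \<open>mult\<close> and \<open>one\<close>, which play no role for modules and are
  left \<open>undefined\<close> in the constructions below.\<close>

subsection \<open>Submodules and quotients\<close>

definition submodule_span ::
    "('a, 'r) ring_scheme \<Rightarrow> ('a, 'm, 'x) module_scheme \<Rightarrow> 'm set \<Rightarrow> 'm set"
  where "submodule_span R M S = \<Inter> {U. submodule U R M \<and> S \<subseteq> U}"

definition fin_gen_module :: "('a, 'r) ring_scheme \<Rightarrow> ('a, 'm, 'x) module_scheme \<Rightarrow> bool"
  where "fin_gen_module R M \<longleftrightarrow>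
    (\<exists>S. finite S \<and> S \<subseteq> carrier M \<and> submodule_span R M S = carrier M)"

definition quot_module :: "('a, 'm, 'x) module_scheme \<Rightarrow> 'm set \<Rightarrow> ('a, 'm set) module"
  where "quot_module M U =
    \<lparr>carrier = a_rcosets\<^bsub>M\<^esub> U, monoid.mult = undefined, one = undefined,
     zero = U, add = set_add M,
     smult = (\<lambda>a C. \<Union>m\<in>C. U +>\<^bsub>M\<^esub> (a \<odot>\<^bsub>M\<^esub> m))\<rparr>"

text \<open>The submodule \<open>I L\<close> of \<open>L\<close>.\<close>

definition ideal_smult ::
    "('a, 'r) ring_scheme \<Rightarrow> 'a set \<Rightarrow> ('a, 'm, 'x) module_scheme \<Rightarrow> 'm set"
  where "ideal_smult R I L =
    submodule_span R L {a \<odot>\<^bsub>L\<^esub> m | a m. a \<in> I \<and> m \<in> carrier L}"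

text \<open>\<open>L / I L\<close> as a module over \<open>R Quot I\<close>; the action of cosets on cosets is written in the
  style of \<open>rcoset_mult\<close>.\<close>

definition residue_module ::
    "('a, 'r) ring_scheme \<Rightarrow> 'a set \<Rightarrow> ('a, 'm, 'x) module_scheme \<Rightarrow> ('a set, 'm set) module"
  where "residue_module R I L =
    \<lparr>carrier = a_rcosets\<^bsub>L\<^esub> (ideal_smult R I L), monoid.mult = undefined, one = undefined,
     zero = ideal_smult R I L, add = set_add L,
     smult = (\<lambda>A C. \<Union>a\<in>A. \<Union>m\<in>C. ideal_smult R I L +>\<^bsub>L\<^esub> (a \<odot>\<^bsub>L\<^esub> m))\<rparr>"

definition self_module :: "('a, 'r) ring_scheme \<Rightarrow> ('a, 'a) module"
  where "self_module R =
    \<lparr>carrier = carrier R, monoid.mult = monoid.mult R, one = \<one>\<^bsub>R\<^esub>, zero = \<zero>\<^bsub>R\<^esub>, add = add R,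
     smult = monoid.mult R\<rparr>"

subsection \<open>Residual faithfulness\<close>

definition annihilator :: "('a, 'r) ring_scheme \<Rightarrow> ('a, 'm, 'x) module_scheme \<Rightarrow> 'a set"
  where "annihilator R L = {a \<in> carrier R. \<forall>m\<in>carrier L. a \<odot>\<^bsub>L\<^esub> m = \<zero>\<^bsub>L\<^esub>}"

definition faithful_module :: "('a, 'r) ring_scheme \<Rightarrow> ('a, 'm, 'x) module_scheme \<Rightarrow> bool"
  where "faithful_module R L \<longleftrightarrow> annihilator R L = {\<zero>\<^bsub>R\<^esub>}"

definition nonzerodivisor_on :: "('a, 'm, 'x) module_scheme \<Rightarrow> 'a \<Rightarrow> bool"
  where "nonzerodivisor_on L x \<longleftrightarrow> (\<forall>m\<in>carrier L. x \<odot>\<^bsub>L\<^esub> m = \<zero>\<^bsub>L\<^esub> \<longrightarrow> m = \<zero>\<^bsub>L\<^esub>)"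

text \<open>The sequence \<open>x\<^sub>1, \<dots>, x\<^sub>n\<close> is regular on \<open>L\<close> if every \<open>x\<^sub>i\<close> is a nonzerodivisor on
  \<open>L / (x\<^sub>1, \<dots>, x\<^sub>i\<^sub>-\<^sub>1) L\<close>. The condition that \<open>(x\<^sub>1, \<dots>, x\<^sub>n) L \<noteq> L\<close>, which some authors add,
  is not imposed: with it the zero module would have no regular sequence of positive length and
  would be vacuously residually faithful. For faithful finitely generated \<open>L\<close> the extra condition
  says just that \<open>(x\<^sub>1, \<dots>, x\<^sub>n)\<close> is a proper ideal.\<close>

definition regular_sequence ::
    "('a, 'r) ring_scheme \<Rightarrow> ('a, 'm, 'x) module_scheme \<Rightarrow> 'a list \<Rightarrow> bool"
  where "regular_sequence R L xs \<longleftrightarrow>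
    set xs \<subseteq> carrier R \<and>
    (\<forall>i<length xs.
       nonzerodivisor_on (quot_module L (ideal_smult R (genideal R (set (take i xs))) L)) (xs ! i))"

definition absolutely_residually_faithful ::
    "nat \<Rightarrow> ('a, 'r) ring_scheme \<Rightarrow> ('a, 'm, 'x) module_scheme \<Rightarrow> bool"
  where "absolutely_residually_faithful n R L \<longleftrightarrow>
    (if n = 0 then faithful_module R L
     else \<forall>xs. length xs = n \<and> regular_sequence R L xs \<longrightarrow>
       faithful_module (R Quot genideal R (set xs)) (residue_module R (genideal R (set xs)) L))"

definition universally_residually_faithful ::
    "nat \<Rightarrow> ('a, 'r) ring_scheme \<Rightarrow> ('a, 'm, 'x) module_scheme \<Rightarrow> bool"
  where "universally_residually_faithful n R L \<longleftrightarrow>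
    (if n = 0 then faithful_module R L
     else \<forall>xs. length xs = n \<and> regular_sequence R (self_module R) xs \<and> regular_sequence R L xs \<longrightarrow>
       faithful_module (R Quot genideal R (set xs)) (residue_module R (genideal R (set xs)) L))"

subsection \<open>Hom and Ext\<close>

definition module_homs ::
    "('a, 'r) ring_scheme \<Rightarrow> ('a, 'm, 'x) module_scheme \<Rightarrow> ('a, 'n, 'y) module_scheme \<Rightarrow> ('m \<Rightarrow> 'n) set"
  where "module_homs R M N =
    {f \<in> carrier M \<rightarrow>\<^sub>E carrier N.
       (\<forall>u\<in>carrier M. \<forall>v\<in>carrier M. f (u \<oplus>\<^bsub>M\<^esub> v) = f u \<oplus>\<^bsub>N\<^esub> f v) \<and>
       (\<forall>a\<in>carrier R. \<forall>u\<in>carrier M. f (a \<odot>\<^bsub>M\<^esub> u) = a \<odot>\<^bsub>N\<^esub> f u)}"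

definition Hom_module ::
    "('a, 'r) ring_scheme \<Rightarrow> ('a, 'm, 'x) module_scheme \<Rightarrow> ('a, 'n, 'y) module_scheme \<Rightarrow> ('a, 'm \<Rightarrow> 'n) module"
  where "Hom_module R M N =
    \<lparr>carrier = module_homs R M N, monoid.mult = undefined, one = undefined,
     zero = (\<lambda>u\<in>carrier M. \<zero>\<^bsub>N\<^esub>),
     add = (\<lambda>f g. \<lambda>u\<in>carrier M. f u \<oplus>\<^bsub>N\<^esub> g u),
     smult = (\<lambda>a f. \<lambda>u\<in>carrier M. a \<odot>\<^bsub>N\<^esub> f u)\<rparr>"

definition free_module :: "('a, 'r) ring_scheme \<Rightarrow> nat \<Rightarrow> ('a, nat \<Rightarrow> 'a) module"
  where "free_module R k =
    \<lparr>carrier = {..<k} \<rightarrow>\<^sub>E carrier R, monoid.mult = undefined, one = undefined,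
     zero = (\<lambda>j\<in>{..<k}. \<zero>\<^bsub>R\<^esub>),
     add = (\<lambda>v w. \<lambda>j\<in>{..<k}. v j \<oplus>\<^bsub>R\<^esub> w j),
     smult = (\<lambda>a v. \<lambda>j\<in>{..<k}. a \<otimes>\<^bsub>R\<^esub> v j)\<rparr>"

text \<open>A resolution \<open>\<dots> \<rightarrow> R\<^bsup>k 2\<^esup> \<rightarrow> R\<^bsup>k 1\<^esup> \<rightarrow> R\<^bsup>k 0\<^esup> \<rightarrow> M \<rightarrow> 0\<close> by finitely generated free modules,
  with differentials \<open>d i : R\<^bsup>k (i+1)\<^esup> \<rightarrow> R\<^bsup>k i\<^esup>\<close> and augmentation \<open>e\<close>. Over a Noetherian ring
  every finitely generated module has one.\<close>

definition free_resolution ::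
    "('a, 'r) ring_scheme \<Rightarrow> ('a, 'm, 'x) module_scheme \<Rightarrow>
     (nat \<Rightarrow> nat) \<Rightarrow> (nat \<Rightarrow> (nat \<Rightarrow> 'a) \<Rightarrow> (nat \<Rightarrow> 'a)) \<Rightarrow> ((nat \<Rightarrow> 'a) \<Rightarrow> 'm) \<Rightarrow> bool"
  where "free_resolution R M k d e \<longleftrightarrow>
    e \<in> module_homs R (free_module R (k 0)) M \<and>
    (\<forall>i. d i \<in> module_homs R (free_module R (k (Suc i))) (free_module R (k i))) \<and>
    e ` carrier (free_module R (k 0)) = carrier M \<and>
    a_kernel (free_module R (k 0)) M e = d 0 ` carrier (free_module R (k 1)) \<and>
    (\<forall>i. a_kernel (free_module R (k (Suc i))) (free_module R (k i)) (d i) =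
         d (Suc i) ` carrier (free_module R (k (Suc (Suc i)))))"

text \<open>The complex \<open>Hom(R\<^bsup>k 0\<^esup>, N) \<rightarrow> Hom(R\<^bsup>k 1\<^esup>, N) \<rightarrow> \<dots>\<close> and its cohomology.\<close>

definition hom_cochains ::
    "('a, 'r) ring_scheme \<Rightarrow> (nat \<Rightarrow> nat) \<Rightarrow> ('a, 'n, 'y) module_scheme \<Rightarrow> nat \<Rightarrow>
     ('a, (nat \<Rightarrow> 'a) \<Rightarrow> 'n) module"
  where "hom_cochains R k N i = Hom_module R (free_module R (k i)) N"

definition hom_differential ::
    "('a, 'r) ring_scheme \<Rightarrow> (nat \<Rightarrow> nat) \<Rightarrow> (nat \<Rightarrow> (nat \<Rightarrow> 'a) \<Rightarrow> (nat \<Rightarrow> 'a)) \<Rightarrow> nat \<Rightarrow>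
     ((nat \<Rightarrow> 'a) \<Rightarrow> 'n) \<Rightarrow> ((nat \<Rightarrow> 'a) \<Rightarrow> 'n)"
  where "hom_differential R k d i f = compose (carrier (free_module R (k (Suc i)))) f (d i)"

definition hom_cohomology ::
    "('a, 'r) ring_scheme \<Rightarrow> (nat \<Rightarrow> nat) \<Rightarrow> (nat \<Rightarrow> (nat \<Rightarrow> 'a) \<Rightarrow> (nat \<Rightarrow> 'a)) \<Rightarrow>
     ('a, 'n, 'y) module_scheme \<Rightarrow> nat \<Rightarrow> ('a, ((nat \<Rightarrow> 'a) \<Rightarrow> 'n) set) module"
  where "hom_cohomology R k d N i =
    quot_module
      ((hom_cochains R k N i)
         \<lparr>carrier := a_kernel (hom_cochains R k N i) (hom_cochains R k N (Suc i))
                      (hom_differential R k d i)\<rparr>)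
      (case i of
         0 \<Rightarrow> {\<zero>\<^bsub>hom_cochains R k N 0\<^esub>}
       | Suc j \<Rightarrow> hom_differential R k d j ` carrier (hom_cochains R k N j))"

text \<open>\<open>Ext\<close> is computed from a chosen resolution of \<open>M\<close>; up to isomorphism the result does not
  depend on the choice. It is the usual \<open>Ext\<close> whenever \<open>M\<close> has a resolution by finitely generated
  free modules, so in particular for \<open>M\<close> finitely generated over a Noetherian ring.\<close>

definition Ext_module ::
    "('a, 'r) ring_scheme \<Rightarrow> nat \<Rightarrow> ('a, 'm, 'x) module_scheme \<Rightarrow> ('a, 'n, 'y) module_scheme \<Rightarrow>
     ('a, ((nat \<Rightarrow> 'a) \<Rightarrow> 'n) set) module"
  where "Ext_module R i M N =
    (let (k, d, e) = (SOME (k, d, e). free_resolution R M k d e)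
     in hom_cohomology R k d N i)"

end

theory Submission
  imports Defs
begin

text \<open>Apply \<open>Hom(-, N)\<close> to a free resolution of \<open>M\<close>. The vanishing of \<open>Ext\<close> makes
  \<open>0 \<rightarrow> Hom(M, N) \<rightarrow> C\<^sup>0 \<rightarrow> C\<^sup>1 \<rightarrow> \<dots> \<rightarrow> C\<^sup>n\<close> exact, where each \<open>C\<^sup>i\<close> is a finite power of
  \<open>N\<close>, so an \<open>N\<close>-regular sequence \<open>x\<close> of length \<open>n\<close> is regular on every \<open>C\<^sup>i\<close>. In a short exact
  sequence \<open>0 \<rightarrow> A \<rightarrow> B \<rightarrow> C \<rightarrow> 0\<close>, a sequence of length \<open>j + 1\<close> regular on \<open>B\<close> whose first \<open>j\<close>
  members are regular on \<open>C\<close> is regular on \<open>A\<close>. Starting from the image in \<open>C\<^sup>n\<close>, on which \<open>x\<^sub>1\<close> is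
  regular, and descending, all of \<open>x\<close> is regular on the image \<open>B\<^sup>1\<close> of \<open>C\<^sup>0\<close> in \<open>C\<^sup>1\<close>. Hence \<open>x\<close> is
  regular on \<open>Hom(M, N)\<close> and \<open>x C\<^sup>0 \<inter> Hom(M, N) = x Hom(M, N)\<close>. So if \<open>a N \<subseteq> x N\<close>, then
  \<open>a Hom(M, N) \<subseteq> x Hom(M, N)\<close>, and faithfulness of \<open>Hom(M, N) / x Hom(M, N)\<close> puts \<open>a\<close> in \<open>(x)\<close>.\<close>

subsection \<open>Regular sequences\<close>

lemma (in abelian_group) add_uminus_cancel:
  "u \<in> carrier G \<Longrightarrow> v \<in> carrier G \<Longrightarrow> u \<oplus> (v \<oplus> \<ominus> u) = v"
  by (subst a_lcomm) (auto simp: r_neg)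

text \<open>Negation is scaling by \<open>\<ominus> \<one>\<close>, so closure under negatives
  follows from closure under scaling.\<close>

lemma (in module) submoduleI_smult:
  assumes "H \<subseteq> carrier M" "\<zero>\<^bsub>M\<^esub> \<in> H"
    and "\<And>u v. u \<in> H \<Longrightarrow> v \<in> H \<Longrightarrow> u \<oplus>\<^bsub>M\<^esub> v \<in> H"
    and smult: "\<And>a u. a \<in> carrier R \<Longrightarrow> u \<in> H \<Longrightarrow> a \<odot>\<^bsub>M\<^esub> u \<in> H"
  shows "submodule H R M"
proof (rule submoduleI)
  fix u assume u: "u \<in> H"
  then have "\<ominus>\<^bsub>M\<^esub> u = (\<ominus> \<one>) \<odot>\<^bsub>M\<^esub> u"
    using assms(1) by (subst smult_l_minus) auto
  then show "\<ominus>\<^bsub>M\<^esub> u \<in> H"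
    using smult u by simp
qed (use assms in auto)

lemma (in module) submodule_zero: "submodule U R M \<Longrightarrow> \<zero>\<^bsub>M\<^esub> \<in> U"
  using subgroup.one_closed[OF submodule.axioms(1)] by fastforce

lemma (in module) submodule_minus:
  "submodule U R M \<Longrightarrow> u \<in> U \<Longrightarrow> v \<in> U \<Longrightarrow> u \<ominus>\<^bsub>M\<^esub> v \<in> U"
  by (simp add: a_minus_def submoduleE)

lemma (in module) submodule_span_submodule:
  assumes "S \<subseteq> carrier M"
  shows "submodule (submodule_span R M S) R M"
proof (rule submoduleI_smult)
  show "submodule_span R M S \<subseteq> carrier M"
    using assms carrier_is_submodule by (auto simp: submodule_span_def)
qed (auto simp: submodule_span_def intro: submodule_zero submoduleE)

lemma submodule_span_superset: "S \<subseteq> submodule_span R M S"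
  by (auto simp: submodule_span_def)

lemma submodule_span_least: "submodule U R M \<Longrightarrow> S \<subseteq> U \<Longrightarrow> submodule_span R M S \<subseteq> U"
  by (auto simp: submodule_span_def)

lemma (in cring) idealI_smult:
  assumes "I \<subseteq> carrier R" "\<zero> \<in> I"
    and "\<And>a b. a \<in> I \<Longrightarrow> b \<in> I \<Longrightarrow> a \<oplus> b \<in> I"
    and smult: "\<And>a b. a \<in> carrier R \<Longrightarrow> b \<in> I \<Longrightarrow> a \<otimes> b \<in> I"
  shows "ideal I R"
proof (rule idealI)
  show "subgroup I (add_monoid R)"
  proof (rule add.subgroupI)
    fix a assume a: "a \<in> I"
    then have "\<ominus> a = (\<ominus> \<one>) \<otimes> a"
      using assms(1) by (subst l_minus) auto
    then show "\<ominus> a \<in> I"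
      using smult a by simp
  qed (use assms in auto)
  fix a x assume "a \<in> I" "x \<in> carrier R"
  then show "a \<otimes> x \<in> I"
    using smult[of x a] m_comm[of a x] assms(1) by auto
qed (use assms ring_axioms in auto)

text \<open>This is the colon ideal \<open>(U : M)\<close>. It contains the ideal generated by a
  sequence as soon as it contains the members of the sequence.\<close>

lemma (in module) ideal_transporter:
  assumes "submodule U R M"
  shows "ideal {a \<in> carrier R. \<forall>m\<in>carrier M. a \<odot>\<^bsub>M\<^esub> m \<in> U} R"
  by (rule idealI_smult)
    (use assms in \<open>auto simp: submodule_zero smult_l_distr smult_assoc1 intro: submoduleE\<close>)

section \<open>The submodule \<open>(x) L\<close> for a finite sequence \<open>x\<close>\<close>

abbreviation seq_smult ::
    "('a, 'r) ring_scheme \<Rightarrow> 'a list \<Rightarrow> ('a, 'm, 'x) module_scheme \<Rightarrow> 'm set"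
  where "seq_smult R xs L \<equiv> ideal_smult R (genideal R (set xs)) L"

lemma (in module) genideal_carrier: "S \<subseteq> carrier R \<Longrightarrow> a \<in> Idl S \<Longrightarrow> a \<in> carrier R"
  using genideal_minimal[OF oneideal] by blast

lemma (in module) seq_smult_submodule:
  assumes "set xs \<subseteq> carrier R"
  shows "submodule (seq_smult R xs M) R M"
  unfolding ideal_smult_def
  by (rule submodule_span_submodule) (use genideal_carrier[OF assms] in auto)

lemma (in module) seq_smult_memI:
  "a \<in> Idl (set xs) \<Longrightarrow> m \<in> carrier M \<Longrightarrow> a \<odot>\<^bsub>M\<^esub> m \<in> seq_smult R xs M"
  unfolding ideal_smult_def by (rule subsetD[OF submodule_span_superset]) auto

text \<open>The members of \<open>xs\<close> lie in the colon ideal of \<open>U\<close>, hence so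
  does the ideal they generate. Inclusions of \<open>(xs) M\<close> can thus be tested on products
  of a member of \<open>xs\<close> with an element of \<open>M\<close>.\<close>

lemma (in module) seq_smult_least:
  assumes "set xs \<subseteq> carrier R" "submodule U R M"
    and "\<And>x m. x \<in> set xs \<Longrightarrow> m \<in> carrier M \<Longrightarrow> x \<odot>\<^bsub>M\<^esub> m \<in> U"
  shows "seq_smult R xs M \<subseteq> U"
proof -
  have "Idl (set xs) \<subseteq> {a \<in> carrier R. \<forall>m\<in>carrier M. a \<odot>\<^bsub>M\<^esub> m \<in> U}"
    by (rule genideal_minimal[OF ideal_transporter[OF assms(2)]]) (use assms in auto)
  then show ?thesis
    unfolding ideal_smult_def by (intro submodule_span_least assms(2)) auto
qed

lemma (in module) seq_smult_empty: "ideal_smult R (Idl {}) M = {\<zero>\<^bsub>M\<^esub>}"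
proof
  have "submodule {\<zero>\<^bsub>M\<^esub>} R M"
    by (rule submoduleI_smult) auto
  then show "ideal_smult R (Idl {}) M \<subseteq> {\<zero>\<^bsub>M\<^esub>}"
    using seq_smult_least[of "[]"] by simp
qed (use submodule_zero[OF seq_smult_submodule[of "[]"]] in auto)

text \<open>A single \<open>m\<close> suffices because \<open>x M\<close> is already a submodule.
  Inductions on membership in \<open>(xs) M\<close> split off the last member of the sequence
  through this decomposition.\<close>

lemma (in module) seq_smult_snoc:
  assumes xs: "set xs \<subseteq> carrier R" and x: "x \<in> carrier R"
  shows "seq_smult R (xs @ [x]) M =
    {x \<odot>\<^bsub>M\<^esub> m \<oplus>\<^bsub>M\<^esub> s | m s. m \<in> carrier M \<and> s \<in> seq_smult R xs M}" (is "?L = ?U")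
proof
  note S = seq_smult_submodule[OF xs]
  have Sc: "s \<in> carrier M" if "s \<in> seq_smult R xs M" for s
    using submoduleE(1)[OF S] that by auto
  have "submodule ?U R M"
  proof (rule submoduleI_smult)
    show "\<zero>\<^bsub>M\<^esub> \<in> ?U"
      using submodule_zero[OF S] x by force
    show "?U \<subseteq> carrier M"
      using x Sc by auto
  next
    fix u v assume "u \<in> ?U" "v \<in> ?U"
    then obtain m s n t where *: "u = x \<odot>\<^bsub>M\<^esub> m \<oplus>\<^bsub>M\<^esub> s" "v = x \<odot>\<^bsub>M\<^esub> n \<oplus>\<^bsub>M\<^esub> t"
      "m \<in> carrier M" "n \<in> carrier M" "s \<in> seq_smult R xs M" "t \<in> seq_smult R xs M"
      by auto
    then have "u \<oplus>\<^bsub>M\<^esub> v = x \<odot>\<^bsub>M\<^esub> (m \<oplus>\<^bsub>M\<^esub> n) \<oplus>\<^bsub>M\<^esub> (s \<oplus>\<^bsub>M\<^esub> t)"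
      using x Sc by (simp add: smult_r_distr M.a_ac)
    then show "u \<oplus>\<^bsub>M\<^esub> v \<in> ?U"
      using * submoduleE(5)[OF S] by blast
  next
    fix a u assume a: "a \<in> carrier R" and "u \<in> ?U"
    then obtain m s where *: "u = x \<odot>\<^bsub>M\<^esub> m \<oplus>\<^bsub>M\<^esub> s" "m \<in> carrier M" "s \<in> seq_smult R xs M"
      by auto
    then have "a \<odot>\<^bsub>M\<^esub> u = x \<odot>\<^bsub>M\<^esub> (a \<odot>\<^bsub>M\<^esub> m) \<oplus>\<^bsub>M\<^esub> (a \<odot>\<^bsub>M\<^esub> s)"
      using x a Sc by (simp add: smult_r_distr m_comm flip: smult_assoc1)
    then show "a \<odot>\<^bsub>M\<^esub> u \<in> ?U"
      using * a submoduleE(4)[OF S] by blast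
  qed
  then show "?L \<subseteq> ?U"
  proof (rule seq_smult_least[rotated])
    fix y m assume y: "y \<in> set (xs @ [x])" and m: "m \<in> carrier M"
    show "y \<odot>\<^bsub>M\<^esub> m \<in> ?U"
    proof (cases "y = x")
      case True
      have "y \<odot>\<^bsub>M\<^esub> m = x \<odot>\<^bsub>M\<^esub> m \<oplus>\<^bsub>M\<^esub> \<zero>\<^bsub>M\<^esub>"
        using True x m by simp
      then show ?thesis
        using submodule_zero[OF S] m by blast
    next
      case False
      then have y: "y \<in> Idl (set xs)"
        using y genideal_self[OF xs] by auto
      then have "y \<odot>\<^bsub>M\<^esub> m = x \<odot>\<^bsub>M\<^esub> \<zero>\<^bsub>M\<^esub> \<oplus>\<^bsub>M\<^esub> y \<odot>\<^bsub>M\<^esub> m"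
        using x m genideal_carrier[OF xs] by simp
      then show ?thesis
        using seq_smult_memI[OF y m] by blast
    qed
  qed (use xs x in auto)
next
  have xsx: "set (xs @ [x]) \<subseteq> carrier R"
    using xs x by auto
  note L = seq_smult_submodule[OF xsx] and self = genideal_self[OF xsx]
  have "seq_smult R xs M \<subseteq> ?L"
    using self by (intro seq_smult_least xs L seq_smult_memI) auto
  moreover have "x \<odot>\<^bsub>M\<^esub> m \<in> ?L" if "m \<in> carrier M" for m
    using self that by (intro seq_smult_memI) auto
  ultimately show "?U \<subseteq> ?L"
    using submoduleE(5)[OF L] by blast
qed

section \<open>Cosets and nonzerodivisors on quotients\<close>

lemma (in module) coset_self_mem: "submodule U R M \<Longrightarrow> m \<in> carrier M \<Longrightarrow> m \<in> U +>\<^bsub>M\<^esub> m"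
  using submodule_zero unfolding a_r_coset_def' by force

lemma (in module) coset_eq_submodule:
  assumes "submodule U R M" "m \<in> carrier M"
  shows "U +>\<^bsub>M\<^esub> m = U \<longleftrightarrow> m \<in> U"
proof
  show "U +>\<^bsub>M\<^esub> m = U \<Longrightarrow> m \<in> U"
    using coset_self_mem[OF assms] by simp
  assume m: "m \<in> U"
  show "U +>\<^bsub>M\<^esub> m = U"
  proof
    show "U +>\<^bsub>M\<^esub> m \<subseteq> U"
      using m submoduleE[OF assms(1)] unfolding a_r_coset_def' by auto
    show "U \<subseteq> U +>\<^bsub>M\<^esub> m"
    proof
      fix u assume u: "u \<in> U"
      then have "u \<in> carrier M"
        using submoduleE(1)[OF assms(1)] by auto
      then have "u = (u \<ominus>\<^bsub>M\<^esub> m) \<oplus>\<^bsub>M\<^esub> m"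
        using assms(2) by (simp add: M.minus_eq M.a_assoc M.l_neg)
      then show "u \<in> U +>\<^bsub>M\<^esub> m"
        using submodule_minus[OF assms(1) u m] unfolding a_r_coset_def' by blast
    qed
  qed
qed

text \<open>The union is how \<open>quot_module\<close> multiplies the coset of \<open>m\<close> by
  \<open>a\<close>. Representatives differ by elements of \<open>U\<close>, which \<open>a\<close>
  maps into \<open>U\<close>, so the given \<open>m\<close> decides whether the product is the zero
  coset.\<close>

lemma (in module) Union_smult_coset_eq:
  assumes "submodule U R M" "a \<in> carrier R" "m \<in> carrier M"
  shows "(\<Union>m'\<in>U +>\<^bsub>M\<^esub> m. U +>\<^bsub>M\<^esub> (a \<odot>\<^bsub>M\<^esub> m')) = U \<longleftrightarrow> a \<odot>\<^bsub>M\<^esub> m \<in> U"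
proof
  assume "(\<Union>m'\<in>U +>\<^bsub>M\<^esub> m. U +>\<^bsub>M\<^esub> (a \<odot>\<^bsub>M\<^esub> m')) = U"
  then have "U +>\<^bsub>M\<^esub> (a \<odot>\<^bsub>M\<^esub> m) \<subseteq> U"
    using coset_self_mem[OF assms(1,3)] by blast
  then show "a \<odot>\<^bsub>M\<^esub> m \<in> U"
    using coset_self_mem[OF assms(1)] assms by blast
next
  assume am: "a \<odot>\<^bsub>M\<^esub> m \<in> U"
  have "U +>\<^bsub>M\<^esub> (a \<odot>\<^bsub>M\<^esub> m') = U" if m': "m' \<in> U +>\<^bsub>M\<^esub> m" for m'
  proof -
    obtain u where u: "u \<in> U" "m' = u \<oplus>\<^bsub>M\<^esub> m"
      using m' unfolding a_r_coset_def' by blast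
    then have "u \<in> carrier M"
      using submoduleE(1)[OF assms(1)] by auto
    then show ?thesis
      using u am assms by (subst coset_eq_submodule) (auto simp: smult_r_distr submoduleE)
  qed
  then show "(\<Union>m'\<in>U +>\<^bsub>M\<^esub> m. U +>\<^bsub>M\<^esub> (a \<odot>\<^bsub>M\<^esub> m')) = U"
    using coset_self_mem[OF assms(1,3)] by blast
qed

text \<open>Passing from cosets to representatives turns regularity into a statement about
  membership in \<open>U\<close>, the form in which it is used from here on.\<close>

lemma (in module) nonzerodivisor_on_quot_module:
  assumes "submodule U R M" "x \<in> carrier R"
  shows "nonzerodivisor_on (quot_module M U) x \<longleftrightarrow>
    (\<forall>m\<in>carrier M. x \<odot>\<^bsub>M\<^esub> m \<in> U \<longrightarrow> m \<in> U)"
  using assms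
  by (simp add: nonzerodivisor_on_def quot_module_def A_RCOSETS_def' Union_smult_coset_eq
      coset_eq_submodule)

lemma (in module) regular_sequence_Nil: "regular_sequence R M []"
  by (simp add: regular_sequence_def)

text \<open>The members of \<open>xs\<close> see the same initial segments with or without
  \<open>x\<close>, so only the condition at \<open>x\<close> is new. If some entry lies outside
  \<open>carrier R\<close>, both sides are false.\<close>

lemma (in module) regular_sequence_snoc:
  "regular_sequence R M (xs @ [x]) \<longleftrightarrow> regular_sequence R M xs \<and> x \<in> carrier R \<and>
    (\<forall>m\<in>carrier M. x \<odot>\<^bsub>M\<^esub> m \<in> seq_smult R xs M \<longrightarrow> m \<in> seq_smult R xs M)"
proof (cases "set xs \<subseteq> carrier R \<and> x \<in> carrier R")
  case True
  then show ?thesis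
    using nonzerodivisor_on_quot_module[OF seq_smult_submodule[of xs], of x]
    by (auto simp: regular_sequence_def nth_append less_Suc_eq)
qed (auto simp: regular_sequence_def)

lemma regular_sequence_set: "regular_sequence R M xs \<Longrightarrow> set xs \<subseteq> carrier R"
  by (simp add: regular_sequence_def)

lemma regular_sequence_take: "regular_sequence R M xs \<Longrightarrow> regular_sequence R M (take i xs)"
  unfolding regular_sequence_def by (auto simp: min_def dest: in_set_takeD)

subsection \<open>Homomorphisms and short exact sequences\<close>

lemma module_homsD:
  assumes "f \<in> module_homs R M N"
  shows "u \<in> carrier M \<Longrightarrow> f u \<in> carrier N"
    and "u \<in> carrier M \<Longrightarrow> v \<in> carrier M \<Longrightarrow> f (u \<oplus>\<^bsub>M\<^esub> v) = f u \<oplus>\<^bsub>N\<^esub> f v"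
    and "a \<in> carrier R \<Longrightarrow> u \<in> carrier M \<Longrightarrow> f (a \<odot>\<^bsub>M\<^esub> u) = a \<odot>\<^bsub>N\<^esub> f u"
  using assms by (auto simp: module_homs_def)

lemma module_homsI:
  assumes "\<And>u. u \<in> carrier M \<Longrightarrow> f u \<in> carrier N" "f \<in> extensional (carrier M)"
    and "\<And>u v. u \<in> carrier M \<Longrightarrow> v \<in> carrier M \<Longrightarrow> f (u \<oplus>\<^bsub>M\<^esub> v) = f u \<oplus>\<^bsub>N\<^esub> f v"
    and "\<And>a u. a \<in> carrier R \<Longrightarrow> u \<in> carrier M \<Longrightarrow> f (a \<odot>\<^bsub>M\<^esub> u) = a \<odot>\<^bsub>N\<^esub> f u"
  shows "f \<in> module_homs R M N"
  using assms by (auto simp: module_homs_def PiE_def)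

lemma module_homs_eqI:
  assumes "f \<in> module_homs R M N" "g \<in> module_homs R M N"
    and "\<And>u. u \<in> carrier M \<Longrightarrow> f u = g u"
  shows "f = g"
  using assms by (auto simp: module_homs_def intro: PiE_ext)

lemma module_homs_zero:
  assumes "module R M" "module R N" and f: "f \<in> module_homs R M N"
  shows "f \<zero>\<^bsub>M\<^esub> = \<zero>\<^bsub>N\<^esub>"
proof -
  interpret M: module R M by fact
  interpret N: module R N by fact
  have "f (\<zero>\<^bsub>R\<^esub> \<odot>\<^bsub>M\<^esub> \<zero>\<^bsub>M\<^esub>) = \<zero>\<^bsub>R\<^esub> \<odot>\<^bsub>N\<^esub> f \<zero>\<^bsub>M\<^esub>"
    by (rule module_homsD[OF f]) auto
  then show ?thesis
    using module_homsD[OF f] by simp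
qed

lemma module_homs_minus:
  assumes "module R M" "module R N" and f: "f \<in> module_homs R M N"
    and uv: "u \<in> carrier M" "v \<in> carrier M"
  shows "f (u \<ominus>\<^bsub>M\<^esub> v) = f u \<ominus>\<^bsub>N\<^esub> f v"
proof -
  interpret M: module R M by fact
  interpret N: module R N by fact
  have *: "\<ominus>\<^bsub>M\<^esub> v = (\<ominus>\<^bsub>R\<^esub> \<one>\<^bsub>R\<^esub>) \<odot>\<^bsub>M\<^esub> v"
    using uv by (simp add: M.smult_l_minus)
  have "f (\<ominus>\<^bsub>M\<^esub> v) = \<ominus>\<^bsub>N\<^esub> f v"
    unfolding * using uv module_homsD[OF f] by (simp add: N.smult_l_minus)
  then show ?thesis
    using uv module_homsD[OF f] by (simp add: M.M.minus_eq N.M.minus_eq)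
qed

lemma module_homs_compose:
  assumes "module R L" "module R M" "f \<in> module_homs R L M" "g \<in> module_homs R M N"
  shows "compose (carrier L) g f \<in> module_homs R L N"
proof -
  interpret L: module R L by fact
  show ?thesis
    by (rule module_homsI) (use assms in \<open>auto simp: compose_eq module_homsD\<close>)
qed

lemma submodule_image:
  assumes "module R M" "module R N" and f: "f \<in> module_homs R M N" and "submodule U R M"
  shows "submodule (f ` U) R N"
proof -
  interpret M: module R M by fact
  interpret N: module R N by fact
  note U = M.submoduleE[OF assms(4)]
  show ?thesis
  proof (rule N.submoduleI_smult)
    show "f ` U \<subseteq> carrier N"
      using U(1) module_homsD(1)[OF f] by auto
    show "\<zero>\<^bsub>N\<^esub> \<in> f ` U"
      using module_homs_zero[OF assms(1-3)] M.submodule_zero[OF assms(4)] by force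
  next
    fix u v assume "u \<in> f ` U" "v \<in> f ` U"
    then obtain s t where *: "s \<in> U" "t \<in> U" "u = f s" "v = f t"
      by blast
    then have "u \<oplus>\<^bsub>N\<^esub> v = f (s \<oplus>\<^bsub>M\<^esub> t)"
      using subsetD[OF U(1)] module_homsD(2)[OF f] by simp
    then show "u \<oplus>\<^bsub>N\<^esub> v \<in> f ` U"
      using * U(5) by auto
  next
    fix a u assume a: "a \<in> carrier R" and "u \<in> f ` U"
    then obtain s where *: "s \<in> U" "u = f s"
      by blast
    then have "a \<odot>\<^bsub>N\<^esub> u = f (a \<odot>\<^bsub>M\<^esub> s)"
      using a U(1) module_homsD(3)[OF f] by auto
    then show "a \<odot>\<^bsub>N\<^esub> u \<in> f ` U"
      using * a U(4) by auto
  qed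
qed

lemma submodule_vimage:
  assumes "module R M" "module R N" and f: "f \<in> module_homs R M N" and "submodule U R N"
  shows "submodule {u \<in> carrier M. f u \<in> U} R M"
proof -
  interpret M: module R M by fact
  interpret N: module R N by fact
  note U = N.submoduleE[OF assms(4)]
  show ?thesis
    by (rule M.submoduleI_smult)
      (auto simp: module_homsD[OF f] module_homs_zero[OF assms(1-3)] U
        intro: N.submodule_zero assms(4))
qed

lemma submodule_a_kernel:
  assumes "module R M" "module R N" "f \<in> module_homs R M N"
  shows "submodule (a_kernel M N f) R M"
proof -
  interpret N: module R N by fact
  have "submodule {\<zero>\<^bsub>N\<^esub>} R N"
    by (rule N.submoduleI_smult) auto
  from submodule_vimage[OF assms this] show ?thesis
    by (simp add: a_kernel_def')
qed

text \<open>The preimage of \<open>(xs) N\<close> under \<open>f\<close> is a submodule that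
  contains the generators of \<open>(xs) M\<close>.\<close>

lemma module_homs_seq_smult:
  assumes "module R M" "module R N" and f: "f \<in> module_homs R M N" and xs: "set xs \<subseteq> carrier R"
    and u: "u \<in> seq_smult R xs M"
  shows "f u \<in> seq_smult R xs N"
proof -
  interpret M: module R M by fact
  interpret N: module R N by fact
  have "seq_smult R xs M \<subseteq> {u \<in> carrier M. f u \<in> seq_smult R xs N}"
  proof (rule M.seq_smult_least[OF xs])
    fix x m assume "x \<in> set xs" "m \<in> carrier M"
    moreover from this have "x \<in> carrier R" "x \<in> genideal R (set xs)"
      using xs M.genideal_self[OF xs] by auto
    ultimately show "x \<odot>\<^bsub>M\<^esub> m \<in> {u \<in> carrier M. f u \<in> seq_smult R xs N}"
      by (auto simp: module_homsD[OF f] intro!: N.seq_smult_memI)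
  qed (rule submodule_vimage[OF assms(1-3) N.seq_smult_submodule[OF xs]])
  then show ?thesis
    using u by auto
qed

text \<open>The image of \<open>(xs) M\<close> is a submodule of \<open>N\<close>, and by
  surjectivity of \<open>f\<close> it contains the generators of \<open>(xs) N\<close>.\<close>

lemma seq_smult_lift:
  assumes "module R M" "module R N" and f: "f \<in> module_homs R M N" "f ` carrier M = carrier N"
    and xs: "set xs \<subseteq> carrier R"
    and v: "v \<in> seq_smult R xs N"
  obtains u where "u \<in> seq_smult R xs M" "f u = v"
proof -
  interpret M: module R M by fact
  interpret N: module R N by fact
  have "seq_smult R xs N \<subseteq> f ` seq_smult R xs M"
  proof (rule N.seq_smult_least[OF xs])
    fix x n assume xn: "x \<in> set xs" "n \<in> carrier N"
    then obtain m where m: "m \<in> carrier M" "n = f m"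
      using f(2) by blast
    have "x \<in> carrier R" "x \<in> genideal R (set xs)"
      using xs M.genideal_self[OF xs] xn by auto
    then show "x \<odot>\<^bsub>N\<^esub> n \<in> f ` seq_smult R xs M"
      using m module_homsD(3)[OF f(1)] by (force intro: M.seq_smult_memI)
  qed (rule submodule_image[OF assms(1-3) M.seq_smult_submodule[OF xs]])
  then show ?thesis
    using v that by auto
qed

text \<open>For an exact sequence \<open>0 \<rightarrow> A \<rightarrow> B \<rightarrow> C \<rightarrow> 0\<close> and a \<open>C\<close>-regular sequence \<open>x\<close> this says
  \<open>x B \<inter> A = x A\<close>.\<close>

lemma exact_seq_smult:
  assumes "module R A" "module R B" "module R C"
    and g: "g \<in> module_homs R A B" "inj_on g (carrier A)" "g ` carrier A = a_kernel B C f"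
    and f: "f \<in> module_homs R B C" "f ` carrier B = carrier C"
    and "regular_sequence R C xs"
    and "a \<in> carrier A" "g a \<in> seq_smult R xs B"
  shows "a \<in> seq_smult R xs A"
proof -
  interpret A: module R A by fact
  interpret B: module R B by fact
  interpret C: module R C by fact
  note gD = module_homsD[OF g(1)] and fD = module_homsD[OF f(1)]
  show ?thesis
    using assms(9-)
  proof (induction xs arbitrary: a rule: rev_induct)
    case Nil
    then have "g a = g \<zero>\<^bsub>A\<^esub>"
      using module_homs_zero[OF assms(1,2) g(1)] by (simp add: B.seq_smult_empty)
    then show ?case
      using Nil g(2) by (auto simp: A.seq_smult_empty inj_on_def)
  next
    case (snoc x xs)
    then have xs: "set xs \<subseteq> carrier R" "regular_sequence R C xs" and x: "x \<in> carrier R"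
      and reg: "\<And>c. c \<in> carrier C \<Longrightarrow> x \<odot>\<^bsub>C\<^esub> c \<in> seq_smult R xs C \<Longrightarrow> c \<in> seq_smult R xs C"
      by (auto simp: C.regular_sequence_snoc dest: regular_sequence_set)
    obtain b s where bs: "b \<in> carrier B" "s \<in> seq_smult R xs B" "g a = x \<odot>\<^bsub>B\<^esub> b \<oplus>\<^bsub>B\<^esub> s"
      using snoc.prems(3) unfolding B.seq_smult_snoc[OF xs(1) x] by auto
    have s: "s \<in> carrier B"
      using bs(2) B.submoduleE(1)[OF B.seq_smult_submodule[OF xs(1)]] by auto
    have "f (g a) = \<zero>\<^bsub>C\<^esub>"
      using g(3) snoc.prems(2) by (auto simp: a_kernel_def')
    then have "x \<odot>\<^bsub>C\<^esub> f b \<oplus>\<^bsub>C\<^esub> f s = \<zero>\<^bsub>C\<^esub>"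
      using bs s x fD by simp
    then have "x \<odot>\<^bsub>C\<^esub> f b = \<ominus>\<^bsub>C\<^esub> f s"
      using bs s x fD by (simp add: C.M.minus_equality)
    \<comment> \<open>Since \<open>f s\<close> lies in \<open>(xs) C\<close>, so does
      \<open>x\<close> times \<open>f b\<close>, and \<open>x\<close> is regular modulo
      \<open>xs\<close> on \<open>C\<close>.\<close>
    then have "f b \<in> seq_smult R xs C"
      using bs module_homs_seq_smult[OF assms(2,3) f(1) xs(1) bs(2)]
        C.submoduleE(3)[OF C.seq_smult_submodule[OF xs(1)]]
      by (intro reg[of "f b"]) (auto simp: fD)
    \<comment> \<open>Subtracting from \<open>b\<close> an element \<open>c\<close> of
      \<open>(xs) B\<close> with the same image under \<open>f\<close> gives an element of the
      kernel, which therefore comes from some \<open>a'\<close> in \<open>A\<close>.\<close>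
    then obtain c where c: "c \<in> seq_smult R xs B" "f c = f b"
      using seq_smult_lift[OF assms(2,3) f xs(1)] by blast
    have cB: "c \<in> carrier B"
      using c(1) B.submoduleE(1)[OF B.seq_smult_submodule[OF xs(1)]] by auto
    have "b \<ominus>\<^bsub>B\<^esub> c \<in> a_kernel B C f"
      using bs cB c fD by (simp add: a_kernel_def' module_homs_minus[OF assms(2,3) f(1)] C.M.minus_eq C.M.r_neg)
    then obtain a' where a': "a' \<in> carrier A" "g a' = b \<ominus>\<^bsub>B\<^esub> c"
      using g(3) by (metis imageE)
    \<comment> \<open>The part of \<open>a\<close> left after removing \<open>x\<close> times
      \<open>a'\<close>. Its image in \<open>B\<close> will be \<open>x\<close> times
      \<open>c\<close> plus \<open>s\<close>, which lies in \<open>(xs) B\<close>, so the induction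
      hypothesis applies to \<open>t\<close>.\<close>
    define t where "t = a \<ominus>\<^bsub>A\<^esub> x \<odot>\<^bsub>A\<^esub> a'"
    have t: "t \<in> carrier A"
      using a' snoc.prems x by (simp add: t_def)
    have "g t = x \<odot>\<^bsub>B\<^esub> c \<oplus>\<^bsub>B\<^esub> s"
    proof -
      have "g t = g a \<ominus>\<^bsub>B\<^esub> x \<odot>\<^bsub>B\<^esub> g a'"
        using a' snoc.prems x gD by (simp add: t_def module_homs_minus[OF assms(1,2) g(1)])
      also have "\<dots> = x \<odot>\<^bsub>B\<^esub> b \<oplus>\<^bsub>B\<^esub> s \<oplus>\<^bsub>B\<^esub> (x \<odot>\<^bsub>B\<^esub> c \<ominus>\<^bsub>B\<^esub> x \<odot>\<^bsub>B\<^esub> b)"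
        using a' bs cB x s
        by (simp add: B.M.minus_eq B.smult_r_distr B.smult_r_minus B.M.minus_add B.M.a_ac)
      also have "\<dots> = x \<odot>\<^bsub>B\<^esub> c \<oplus>\<^bsub>B\<^esub> s"
        using bs cB x s by (simp add: B.M.minus_eq B.M.a_ac B.M.add_uminus_cancel)
      finally show ?thesis .
    qed
    then have "g t \<in> seq_smult R xs B"
      using c bs x B.submoduleE[OF B.seq_smult_submodule[OF xs(1)]] by simp
    then have "t \<in> seq_smult R xs A"
      using snoc.IH xs t by blast
    moreover have "a = x \<odot>\<^bsub>A\<^esub> a' \<oplus>\<^bsub>A\<^esub> t"
      using a' snoc.prems x by (simp add: t_def A.M.minus_eq A.M.add_uminus_cancel)
    ultimately show ?case
      using a' unfolding A.seq_smult_snoc[OF xs(1) x] by blast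
  qed
qed

text \<open>If \<open>x\<close> times \<open>a\<close> lies in \<open>(xs) A\<close>, regularity on
  \<open>B\<close> puts \<open>g a\<close> in \<open>(xs) B\<close>, and
  \<open>exact_seq_smult\<close> brings \<open>a\<close> back into \<open>(xs) A\<close>. That last
  step uses regularity on \<open>C\<close> only for the members before \<open>x\<close>, hence the
  \<open>butlast\<close>.\<close>

lemma exact_regular_sequence:
  assumes "module R A" "module R B" "module R C"
    and g: "g \<in> module_homs R A B" "inj_on g (carrier A)" "g ` carrier A = a_kernel B C f"
    and f: "f \<in> module_homs R B C" "f ` carrier B = carrier C"
    and "regular_sequence R B xs" "regular_sequence R C (butlast xs)"
  shows "regular_sequence R A xs"
proof -
  interpret A: module R A by fact
  interpret B: module R B by fact
  interpret C: module R C by fact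
  show ?thesis
    using assms(9-)
  proof (induction xs rule: rev_induct)
    case Nil
    then show ?case
      by (simp add: A.regular_sequence_Nil)
  next
    case (snoc x xs)
    then have B: "regular_sequence R B xs" and x: "x \<in> carrier R"
      and reg: "\<And>b. b \<in> carrier B \<Longrightarrow> x \<odot>\<^bsub>B\<^esub> b \<in> seq_smult R xs B \<Longrightarrow> b \<in> seq_smult R xs B"
      by (auto simp: B.regular_sequence_snoc)
    have C: "regular_sequence R C xs"
      using snoc.prems by simp
    have "a \<in> seq_smult R xs A" if a: "a \<in> carrier A" "x \<odot>\<^bsub>A\<^esub> a \<in> seq_smult R xs A" for a
    proof -
      have "g (x \<odot>\<^bsub>A\<^esub> a) \<in> seq_smult R xs B"
        using a regular_sequence_set[OF B] by (intro module_homs_seq_smult[OF assms(1,2) g(1)])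
      then have "g a \<in> seq_smult R xs B"
        using a x by (intro reg[of "g a"]) (auto simp: module_homsD[OF g(1)])
      then show ?thesis
        using exact_seq_smult[OF assms(1-8) C a(1)] by blast
    qed
    \<comment> \<open>For the shorter sequence the induction hypothesis asks for regularity of
      \<open>butlast xs\<close> on \<open>C\<close>, a truncation of what is known.\<close>
    moreover have "regular_sequence R A xs"
      using snoc.IH B regular_sequence_take[OF C, of "length xs - 1"]
      by (simp add: butlast_conv_take)
    ultimately show ?case
      using x by (simp add: A.regular_sequence_snoc)
  qed
qed

subsection \<open>Hom modules and free modules\<close>

lemma Hom_module_simps:
  "carrier (Hom_module R M N) = module_homs R M N"
  "\<zero>\<^bsub>Hom_module R M N\<^esub> = (\<lambda>u\<in>carrier M. \<zero>\<^bsub>N\<^esub>)"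
  "f \<oplus>\<^bsub>Hom_module R M N\<^esub> g = (\<lambda>u\<in>carrier M. f u \<oplus>\<^bsub>N\<^esub> g u)"
  "a \<odot>\<^bsub>Hom_module R M N\<^esub> f = (\<lambda>u\<in>carrier M. a \<odot>\<^bsub>N\<^esub> f u)"
  by (simp_all add: Hom_module_def)

lemma Hom_module_is_module:
  assumes "module R M" "module R N"
  shows "module R (Hom_module R M N)"
proof -
  interpret M: module R M by fact
  interpret N: module R N by fact
  have zero: "(\<lambda>u\<in>carrier M. \<zero>\<^bsub>N\<^esub>) \<in> module_homs R M N"
    by (rule module_homsI) auto
  have add: "(\<lambda>u\<in>carrier M. f u \<oplus>\<^bsub>N\<^esub> g u) \<in> module_homs R M N"
    if "f \<in> module_homs R M N" "g \<in> module_homs R M N" for f g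
    by (rule module_homsI)
      (auto simp: module_homsD[OF that(1)] module_homsD[OF that(2)] N.smult_r_distr N.M.a_ac)
  have smult: "(\<lambda>u\<in>carrier M. a \<odot>\<^bsub>N\<^esub> f u) \<in> module_homs R M N"
    if "a \<in> carrier R" and f: "f \<in> module_homs R M N" for a f
    by (rule module_homsI)
      (use that(1) in \<open>auto simp: module_homsD[OF f] N.smult_r_distr M.m_comm
        simp flip: N.smult_assoc1\<close>)
  have ext: "f = g" if "f \<in> extensional (carrier M)" "g \<in> extensional (carrier M)"
    "\<And>u. u \<in> carrier M \<Longrightarrow> f u = g u" for f g :: "'c \<Rightarrow> 'e"
    by (rule extensionalityI[OF that])
  have extD: "f \<in> extensional (carrier M)" if "f \<in> module_homs R M N" for f
    using that by (auto simp: module_homs_def PiE_def)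
  show ?thesis
  proof (rule moduleI[OF M.is_cring], rule abelian_groupI)
    fix f assume f: "f \<in> carrier (Hom_module R M N)"
    have "(\<lambda>u\<in>carrier M. (\<ominus>\<^bsub>R\<^esub> \<one>\<^bsub>R\<^esub>) \<odot>\<^bsub>N\<^esub> f u) \<oplus>\<^bsub>Hom_module R M N\<^esub> f = \<zero>\<^bsub>Hom_module R M N\<^esub>"
      using f by (auto simp: Hom_module_simps N.smult_l_minus N.M.l_neg module_homsD intro!: ext)
    moreover have "(\<lambda>u\<in>carrier M. (\<ominus>\<^bsub>R\<^esub> \<one>\<^bsub>R\<^esub>) \<odot>\<^bsub>N\<^esub> f u) \<in> carrier (Hom_module R M N)"
      using smult[of "\<ominus>\<^bsub>R\<^esub> \<one>\<^bsub>R\<^esub>" f] f by (simp add: Hom_module_simps)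
    ultimately show "\<exists>g\<in>carrier (Hom_module R M N).
        g \<oplus>\<^bsub>Hom_module R M N\<^esub> f = \<zero>\<^bsub>Hom_module R M N\<^esub>"
      by blast
  qed (auto simp: Hom_module_simps zero add smult module_homsD N.M.a_ac N.smult_l_distr
      N.smult_r_distr N.smult_assoc1 extD intro!: ext)
qed

section \<open>Finite free modules and their standard bases\<close>

lemma free_module_simps:
  "carrier (free_module R k) = {..<k} \<rightarrow>\<^sub>E carrier R"
  "\<zero>\<^bsub>free_module R k\<^esub> = (\<lambda>j\<in>{..<k}. \<zero>\<^bsub>R\<^esub>)"
  "v \<oplus>\<^bsub>free_module R k\<^esub> w = (\<lambda>j\<in>{..<k}. v j \<oplus>\<^bsub>R\<^esub> w j)"
  "a \<odot>\<^bsub>free_module R k\<^esub> v = (\<lambda>j\<in>{..<k}. a \<otimes>\<^bsub>R\<^esub> v j)"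
  by (simp_all add: free_module_def)

lemma free_module_is_module:
  assumes "cring R"
  shows "module R (free_module R k)"
proof -
  interpret cring R by fact
  have mem: "v j \<in> carrier R" if "v \<in> {..<k} \<rightarrow>\<^sub>E carrier R" "j < k" for v j
    using that by auto
  show ?thesis
  proof (rule moduleI[OF is_cring], rule abelian_groupI)
    fix v assume v: "v \<in> carrier (free_module R k)"
    have "(\<lambda>j\<in>{..<k}. \<ominus>\<^bsub>R\<^esub> v j) \<oplus>\<^bsub>free_module R k\<^esub> v = \<zero>\<^bsub>free_module R k\<^esub>"
      unfolding free_module_simps
      by (rule restrict_ext) (use v in \<open>simp add: free_module_simps l_neg mem\<close>)
    moreover have "(\<lambda>j\<in>{..<k}. \<ominus>\<^bsub>R\<^esub> v j) \<in> carrier (free_module R k)"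
      using v by (auto simp: free_module_simps)
    ultimately show "\<exists>w\<in>carrier (free_module R k).
        w \<oplus>\<^bsub>free_module R k\<^esub> v = \<zero>\<^bsub>free_module R k\<^esub>"
      by blast
  qed (simp_all add: free_module_simps mem a_ac l_distr r_distr m_assoc restrict_PiE_iff
      PiE_restrict cong: restrict_cong)
qed

text \<open>The standard basis vectors, restricted to \<open>{..<k}\<close> because the elements of
  \<open>free_module R k\<close> are extensional functions.\<close>

definition unit_vec :: "('a, 'r) ring_scheme \<Rightarrow> nat \<Rightarrow> nat \<Rightarrow> nat \<Rightarrow> 'a"
  where "unit_vec R k i = (\<lambda>j\<in>{..<k}. if i = j then \<one>\<^bsub>R\<^esub> else \<zero>\<^bsub>R\<^esub>)"

lemma (in cring) unit_vec_closed: "unit_vec R k i \<in> carrier (free_module R k)"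
  by (auto simp: unit_vec_def free_module_simps)

text \<open>The unit vectors generate: the truncation of \<open>v\<close> to its first
  \<open>i\<close> coordinates lies in \<open>U\<close> by induction on \<open>i\<close>, each step
  adding a multiple of one unit vector.\<close>

lemma (in cring) free_module_subset:
  assumes U: "submodule U R (free_module R k)" and e: "\<And>i. i < k \<Longrightarrow> unit_vec R k i \<in> U"
  shows "carrier (free_module R k) \<subseteq> U"
proof
  interpret F: module R "free_module R k"
    by (rule free_module_is_module) (rule is_cring)
  fix v assume v: "v \<in> carrier (free_module R k)"
  then have mem: "v j \<in> carrier R" if "j < k" for j
    using that by (auto simp: free_module_simps)
  have "(\<lambda>j\<in>{..<k}. if j < i then v j else \<zero>) \<in> U" if "i \<le> k" for i
    using that
  proof (induction i)
    case 0
    then show ?case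
      using F.submodule_zero[OF U] by (simp add: free_module_simps restrict_def)
  next
    case (Suc i)
    have eq: "(\<lambda>j\<in>{..<k}. if j < Suc i then v j else \<zero>) =
      (\<lambda>j\<in>{..<k}. if j < i then v j else \<zero>) \<oplus>\<^bsub>free_module R k\<^esub>
        (v i \<odot>\<^bsub>free_module R k\<^esub> unit_vec R k i)"
      using Suc.prems
      by (auto simp: free_module_simps unit_vec_def mem less_Suc_eq intro!: restrict_ext)
    have "v i \<odot>\<^bsub>free_module R k\<^esub> unit_vec R k i \<in> U"
      using Suc.prems by (intro F.submoduleE(4)[OF U] e mem) auto
    then show ?case
      unfolding eq using Suc.prems by (intro F.submoduleE(5)[OF U Suc.IH]) auto
  qed
  from this[of k] have "(\<lambda>j\<in>{..<k}. if j < k then v j else \<zero>) \<in> U"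
    by simp
  moreover have "(\<lambda>j\<in>{..<k}. if j < k then v j else \<zero>) = v"
    using restrict_ext[of "{..<k}" "\<lambda>j. if j < k then v j else \<zero>" v] v
    by (simp add: free_module_simps PiE_restrict)
  ultimately show "v \<in> U"
    by simp
qed

text \<open>Freeness of \<open>R^k\<close>: the map sends \<open>v\<close> to the sum of the
  \<open>v j\<close> times \<open>m j\<close>.\<close>

lemma free_module_hom_exists:
  assumes "module R N" and m: "\<And>i. i < k \<Longrightarrow> m i \<in> carrier N"
  obtains g where "g \<in> module_homs R (free_module R k) N"
    and "\<And>i. i < k \<Longrightarrow> g (unit_vec R k i) = m i"
proof -
  interpret N: module R N by fact
  define g where "g = (\<lambda>v\<in>carrier (free_module R k). \<Oplus>\<^bsub>N\<^esub>j\<in>{..<k}. v j \<odot>\<^bsub>N\<^esub> m j)"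
  interpret F: module R "free_module R k"
    by (rule free_module_is_module) (rule N.is_cring)
  have mem: "v j \<in> carrier R" if "v \<in> carrier (free_module R k)" "j < k" for v j
    using that by (auto simp: free_module_simps)
  have "g \<in> module_homs R (free_module R k) N"
  proof (rule module_homsI)
    fix v w assume vw: "v \<in> carrier (free_module R k)" "w \<in> carrier (free_module R k)"
    have "g (v \<oplus>\<^bsub>free_module R k\<^esub> w) =
      (\<Oplus>\<^bsub>N\<^esub>j\<in>{..<k}. (v \<oplus>\<^bsub>free_module R k\<^esub> w) j \<odot>\<^bsub>N\<^esub> m j)"
      using F.M.a_closed[OF vw] by (simp add: g_def)
    also have "\<dots> = (\<Oplus>\<^bsub>N\<^esub>j\<in>{..<k}. v j \<odot>\<^bsub>N\<^esub> m j \<oplus>\<^bsub>N\<^esub> w j \<odot>\<^bsub>N\<^esub> m j)"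
      by (rule N.M.finsum_cong')
        (use vw in \<open>auto simp: free_module_simps(3) N.smult_l_distr mem m\<close>)
    also have "\<dots> = g v \<oplus>\<^bsub>N\<^esub> g w"
      using vw by (subst N.M.finsum_addf) (auto simp: g_def mem m)
    finally show "g (v \<oplus>\<^bsub>free_module R k\<^esub> w) = g v \<oplus>\<^bsub>N\<^esub> g w" .
  next
    fix a v assume a: "a \<in> carrier R" and v: "v \<in> carrier (free_module R k)"
    have "g (a \<odot>\<^bsub>free_module R k\<^esub> v) =
      (\<Oplus>\<^bsub>N\<^esub>j\<in>{..<k}. (a \<odot>\<^bsub>free_module R k\<^esub> v) j \<odot>\<^bsub>N\<^esub> m j)"
      using F.smult_closed[OF a v] by (simp add: g_def)
    also have "\<dots> = (\<Oplus>\<^bsub>N\<^esub>j\<in>{..<k}. a \<odot>\<^bsub>N\<^esub> (v j \<odot>\<^bsub>N\<^esub> m j))"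
      by (rule N.M.finsum_cong')
        (use a v in \<open>auto simp: free_module_simps(4) N.smult_assoc1 mem m\<close>)
    also have "\<dots> = a \<odot>\<^bsub>N\<^esub> g v"
      using a v by (subst N.finsum_smult_ldistr[symmetric]) (auto simp: g_def mem m)
    finally show "g (a \<odot>\<^bsub>free_module R k\<^esub> v) = a \<odot>\<^bsub>N\<^esub> g v" .
  qed (auto simp: g_def mem m intro!: N.M.finsum_closed)
  moreover have "g (unit_vec R k i) = m i" if i: "i < k" for i
  proof -
    have "g (unit_vec R k i) = (\<Oplus>\<^bsub>N\<^esub>j\<in>{..<k}. unit_vec R k i j \<odot>\<^bsub>N\<^esub> m j)"
      using N.unit_vec_closed[of k i] by (simp add: g_def)
    also have "\<dots> = (\<Oplus>\<^bsub>N\<^esub>j\<in>{..<k}. if i = j then m j else \<zero>\<^bsub>N\<^esub>)"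
      by (rule N.M.finsum_cong') (auto simp: unit_vec_def m)
    also have "\<dots> = m i"
      using i by (intro N.M.finsum_singleton) (auto simp: m)
    finally show ?thesis .
  qed
  ultimately show ?thesis
    using that by blast
qed

section \<open>Regular sequences on \<open>Hom(R^k, N)\<close>\<close>

lemma Hom_module_eval:
  assumes "module R M" "module R N" "u \<in> carrier M"
  shows "(\<lambda>f\<in>carrier (Hom_module R M N). f u) \<in> module_homs R (Hom_module R M N) N"
proof -
  interpret H: module R "Hom_module R M N"
    by (rule Hom_module_is_module) fact+
  show ?thesis
  proof (rule module_homsI)
    fix f g assume "f \<in> carrier (Hom_module R M N)" "g \<in> carrier (Hom_module R M N)"
    then show "(\<lambda>f\<in>carrier (Hom_module R M N). f u) (f \<oplus>\<^bsub>Hom_module R M N\<^esub> g) =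
      (\<lambda>f\<in>carrier (Hom_module R M N). f u) f \<oplus>\<^bsub>N\<^esub> (\<lambda>f\<in>carrier (Hom_module R M N). f u) g"
      using H.M.a_closed[of f g] assms(3) by (simp add: Hom_module_simps(3))
  next
    fix a f assume "a \<in> carrier R" "f \<in> carrier (Hom_module R M N)"
    then show "(\<lambda>f\<in>carrier (Hom_module R M N). f u) (a \<odot>\<^bsub>Hom_module R M N\<^esub> f) =
      a \<odot>\<^bsub>N\<^esub> (\<lambda>f\<in>carrier (Hom_module R M N). f u) f"
      using H.smult_closed[of a f] assms(3) by (simp add: Hom_module_simps(4))
  qed (use assms(3) in \<open>auto simp: Hom_module_simps module_homsD\<close>)
qed

text \<open>Evaluation at \<open>u\<close> is a homomorphism from \<open>Hom(M, N)\<close> to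
  \<open>N\<close>, and homomorphisms carry \<open>(xs)\<close> multiples to
  \<open>(xs) N\<close>.\<close>

lemma Hom_module_seq_smult_eval:
  assumes "module R M" "module R N" "set xs \<subseteq> carrier R" "u \<in> carrier M"
    and f: "f \<in> seq_smult R xs (Hom_module R M N)"
  shows "f u \<in> seq_smult R xs N"
proof -
  interpret H: module R "Hom_module R M N"
    by (rule Hom_module_is_module) fact+
  have "f \<in> carrier (Hom_module R M N)"
    using f H.submoduleE(1)[OF H.seq_smult_submodule[OF assms(3)]] by auto
  then show ?thesis
    using module_homs_seq_smult[OF H.module_axioms assms(2) Hom_module_eval[OF assms(1,2,4)] assms(3) f]
    by simp
qed

text \<open>Under \<open>Hom(R^k, N) = N^k\<close> this says that \<open>(xs) N^k\<close> is formed
  coordinatewise. Instead of building the isomorphism, the proof splits the values on the unit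
  vectors and lifts the pieces to homomorphisms by freeness.\<close>

lemma Hom_free_module_seq_smult:
  assumes "module R N" "set xs \<subseteq> carrier R"
    and "f \<in> module_homs R (free_module R k) N"
    and "\<And>i. i < k \<Longrightarrow> f (unit_vec R k i) \<in> seq_smult R xs N"
  shows "f \<in> seq_smult R xs (Hom_module R (free_module R k) N)"
proof -
  interpret N: module R N by fact
  interpret F: module R "free_module R k"
    by (rule free_module_is_module) (rule N.is_cring)
  let ?H = "Hom_module R (free_module R k) N"
  interpret H: module R ?H
    by (rule Hom_module_is_module) (rule F.module_axioms, fact)
  note e = N.unit_vec_closed[of k]
  show ?thesis
    using assms(2-)
  proof (induction xs arbitrary: f rule: rev_induct)
    case Nil
    \<comment> \<open>For the empty sequence \<open>f\<close> vanishes on all unit vectors, so its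
      kernel is everything and \<open>f\<close> is zero.\<close>
    have "submodule (a_kernel (free_module R k) N f) R (free_module R k)"
      by (rule submodule_a_kernel) (use Nil.prems F.module_axioms assms(1) in auto)
    then have "carrier (free_module R k) \<subseteq> a_kernel (free_module R k) N f"
      using Nil.prems(3) by (intro N.free_module_subset)
        (auto simp: a_kernel_def' e N.seq_smult_empty)
    then have "f = \<zero>\<^bsub>?H\<^esub>"
      using Nil.prems(2) H.M.zero_closed
      by (intro module_homs_eqI[of f R "free_module R k" N])
        (auto simp: Hom_module_simps a_kernel_def')
    then show ?case
      by (simp add: H.seq_smult_empty)
  next
    case (snoc x xs)
    then have xs: "set xs \<subseteq> carrier R" and x: "x \<in> carrier R"
      by auto
    have "\<forall>i. i < k \<longrightarrow> (\<exists>m s. m \<in> carrier N \<and> s \<in> seq_smult R xs N \<and>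
        f (unit_vec R k i) = x \<odot>\<^bsub>N\<^esub> m \<oplus>\<^bsub>N\<^esub> s)"
      using snoc.prems(3) unfolding N.seq_smult_snoc[OF xs x] by blast
    then obtain m s where ms: "\<And>i. i < k \<Longrightarrow> m i \<in> carrier N"
      "\<And>i. i < k \<Longrightarrow> s i \<in> seq_smult R xs N"
      "\<And>i. i < k \<Longrightarrow> f (unit_vec R k i) = x \<odot>\<^bsub>N\<^esub> m i \<oplus>\<^bsub>N\<^esub> s i"
      by metis
    obtain g where g: "g \<in> module_homs R (free_module R k) N"
      and gm: "\<And>i. i < k \<Longrightarrow> g (unit_vec R k i) = m i"
      by (rule free_module_hom_exists[OF assms(1), of k m]) (use ms(1) in blast)+
    have gH: "g \<in> carrier ?H" and fH: "f \<in> carrier ?H"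
      using g snoc.prems by (auto simp: Hom_module_simps)
    \<comment> \<open>Since \<open>g\<close> takes the values \<open>m i\<close>, the difference
      \<open>h\<close> takes the values \<open>s i\<close> in \<open>(xs) N\<close> on the unit
      vectors, and the induction hypothesis applies to it.\<close>
    define h where "h = f \<ominus>\<^bsub>?H\<^esub> x \<odot>\<^bsub>?H\<^esub> g"
    have hH: "h \<in> carrier ?H"
      using gH fH x by (simp add: h_def)
    have fxg: "f = x \<odot>\<^bsub>?H\<^esub> g \<oplus>\<^bsub>?H\<^esub> h"
      using gH fH x by (simp add: h_def H.M.minus_eq H.M.add_uminus_cancel)
    have "h (unit_vec R k i) = s i" if i: "i < k" for i
    proof -
      have "s i \<in> carrier N"
        using ms(2)[OF i] N.submoduleE(1)[OF N.seq_smult_submodule[OF xs]] by auto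
      moreover have "h (unit_vec R k i) \<in> carrier N"
        using hH e by (simp add: Hom_module_simps module_homsD)
      moreover have "x \<odot>\<^bsub>N\<^esub> m i \<oplus>\<^bsub>N\<^esub> h (unit_vec R k i) = x \<odot>\<^bsub>N\<^esub> m i \<oplus>\<^bsub>N\<^esub> s i"
        using fun_cong[OF fxg, of "unit_vec R k i"] gm[OF i] ms(3)[OF i] e
        by (simp add: Hom_module_simps)
      ultimately show ?thesis
        using N.smult_closed[OF x ms(1)[OF i]] by (metis N.M.add.l_cancel)
    qed
    then have "h \<in> seq_smult R xs ?H"
      using hH ms(2) by (intro snoc.IH xs) (simp_all add: Hom_module_simps)
    then show ?case
      unfolding H.seq_smult_snoc[OF xs x] using fxg gH by blast
  qed
qed

text \<open>Membership in \<open>(xs) Hom(R^k, N)\<close> can be tested on the values at the unit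
  vectors, and there the condition on \<open>x\<close> is regularity on \<open>N\<close>.\<close>

lemma Hom_free_module_regular_sequence:
  assumes "module R N" "regular_sequence R N xs"
  shows "regular_sequence R (Hom_module R (free_module R k) N) xs"
proof -
  interpret N: module R N by fact
  interpret F: module R "free_module R k"
    by (rule free_module_is_module) (rule N.is_cring)
  let ?H = "Hom_module R (free_module R k) N"
  interpret H: module R ?H
    by (rule Hom_module_is_module) (rule F.module_axioms, fact)
  show ?thesis
    using assms(2)
  proof (induction xs rule: rev_induct)
    case Nil
    then show ?case
      by (simp add: H.regular_sequence_Nil)
  next
    case (snoc x xs)
    then have N: "regular_sequence R N xs" and x: "x \<in> carrier R"
      and reg: "\<And>m. m \<in> carrier N \<Longrightarrow> x \<odot>\<^bsub>N\<^esub> m \<in> seq_smult R xs N \<Longrightarrow> m \<in> seq_smult R xs N"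
      by (auto simp: N.regular_sequence_snoc)
    have "f \<in> seq_smult R xs ?H" if f: "f \<in> carrier ?H" "x \<odot>\<^bsub>?H\<^esub> f \<in> seq_smult R xs ?H" for f
    proof (rule Hom_free_module_seq_smult[OF assms(1) regular_sequence_set[OF N]])
      show fh: "f \<in> module_homs R (free_module R k) N"
        using f by (simp add: Hom_module_simps)
      fix i assume "i < k"
      have "(x \<odot>\<^bsub>?H\<^esub> f) (unit_vec R k i) \<in> seq_smult R xs N"
        using f(2) by (intro Hom_module_seq_smult_eval[OF F.module_axioms assms(1)
              regular_sequence_set[OF N] N.unit_vec_closed])
      then show "f (unit_vec R k i) \<in> seq_smult R xs N"
        using N.unit_vec_closed[of k i]
        by (intro reg[of "f (unit_vec R k i)"])
          (auto simp: Hom_module_simps(4) module_homsD[OF fh])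
    qed
    then show ?case
      using snoc.IH N x by (simp add: H.regular_sequence_snoc)
  qed
qed

subsection \<open>Existence of free resolutions\<close>

text \<open>Send the unit vectors to an enumeration of \<open>S\<close>. Generation of
  \<open>U\<close> is phrased through submodules of \<open>L\<close>, so that the lemma covers both
  a finitely generated module itself and a kernel inside a free module.\<close>

lemma free_module_cover:
  assumes "module R L" "submodule U R L" "finite S" "S \<subseteq> U"
    and gen: "\<And>V. submodule V R L \<Longrightarrow> S \<subseteq> V \<Longrightarrow> U \<subseteq> V"
  obtains k g where "g \<in> module_homs R (free_module R k) L" "g ` carrier (free_module R k) = U"
proof -
  interpret L: module R L by fact
  obtain h where h: "bij_betw h {0..<card S} S"
    using ex_bij_betw_nat_finite[OF assms(3)] by blast
  define k where "k = card S"
  have hS: "h ` {..<k} = S"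
    using h by (auto simp: bij_betw_def k_def atLeast0LessThan)
  have hU: "h i \<in> U" if "i < k" for i
    using that hS assms(4) by blast
  have "h i \<in> carrier L" if "i < k" for i
    using hU[OF that] L.submoduleE(1)[OF assms(2)] by blast
  then obtain g where g: "g \<in> module_homs R (free_module R k) L"
    and gh: "\<And>i. i < k \<Longrightarrow> g (unit_vec R k i) = h i"
    using free_module_hom_exists[OF assms(1), of k h] by blast
  interpret F: module R "free_module R k"
    by (rule free_module_is_module) (rule L.is_cring)
  note e = L.unit_vec_closed[of k]
  have "carrier (free_module R k) \<subseteq> {v \<in> carrier (free_module R k). g v \<in> U}"
    by (intro L.free_module_subset submodule_vimage[OF F.module_axioms assms(1) g assms(2)])
      (auto simp: e gh hU)
  moreover have "h i \<in> g ` carrier (free_module R k)" if "i < k" for i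
    using gh[OF that, symmetric] e by simp
  then have "U \<subseteq> g ` carrier (free_module R k)"
    using hS
    by (intro gen submodule_image[OF F.module_axioms assms(1) g F.carrier_is_submodule]) blast
  ultimately show ?thesis
    using that[OF g] by blast
qed

text \<open>Submodules of \<open>R^k\<close> are finitely generated. The values of one coordinate on
  \<open>U\<close> form a finitely generated ideal; lifts of its generators, together with
  generators of the part of \<open>U\<close> where this coordinate vanishes, generate
  \<open>U\<close>.\<close>

lemma free_module_noetherian:
  fixes R (structure)
  assumes "cring R" "noetherian_ring R" "submodule U R (free_module R k)"
  obtains S where "finite S" "S \<subseteq> U"
    and "\<And>V. submodule V R (free_module R k) \<Longrightarrow> S \<subseteq> V \<Longrightarrow> U \<subseteq> V"
proof -
  interpret cring R by fact
  interpret noetherian_ring R by fact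
  let ?F = "free_module R k"
  interpret F: module R ?F
    by (rule free_module_is_module) fact
  \<comment> \<open>Induction on the number \<open>j\<close> of leading coordinates in which members
    of \<open>U\<close> may be nonzero; \<open>j = k\<close> is the claim.\<close>
  have "\<exists>S. finite S \<and> S \<subseteq> U \<and> (\<forall>V. submodule V R ?F \<longrightarrow> S \<subseteq> V \<longrightarrow> U \<subseteq> V)"
    if "j \<le> k" "submodule U R ?F" "\<And>v i. v \<in> U \<Longrightarrow> j \<le> i \<Longrightarrow> i < k \<Longrightarrow> v i = \<zero>" for j U
    using that
  proof (induction j arbitrary: U)
    case 0
    have "v = \<zero>\<^bsub>?F\<^esub>" if "v \<in> U" for v
    proof -
      have "v \<in> {..<k} \<rightarrow>\<^sub>E carrier R"
        using F.submoduleE(1)[OF 0(2)] that by (auto simp: free_module_simps)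
      then show ?thesis
        using 0(3)[OF that] F.M.zero_closed by (intro PiE_ext[of v "{..<k}" "\<lambda>_. carrier R"])
          (auto simp: free_module_simps)
    qed
    then show ?case
      using F.submodule_zero by (intro exI[of _ "{}"]) auto
  next
    case (Suc j)
    then have j: "j < k"
      by simp
    note U = F.submoduleE[OF Suc.prems(2)]
    have app: "v j \<in> carrier R" if "v \<in> carrier ?F" for v
      using that j by (auto simp: free_module_simps)
    \<comment> \<open>Stated for every submodule \<open>W\<close>, since it is applied to
      \<open>U\<close> and later to \<open>U \<inter> V\<close>.\<close>
    have coord: "ideal ((\<lambda>v. v j) ` W) R" if W: "submodule W R ?F" for W
    proof (rule idealI_smult)
      note WE = F.submoduleE[OF W]
      show "(\<lambda>v. v j) ` W \<subseteq> carrier R"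
        using WE(1) app by auto
      have "\<zero> = \<zero>\<^bsub>?F\<^esub> j"
        using j by (simp add: free_module_simps)
      then show "\<zero> \<in> (\<lambda>v. v j) ` W"
        using F.submodule_zero[OF W] by blast
    next
      note WE = F.submoduleE[OF W]
      fix a b assume "a \<in> (\<lambda>v. v j) ` W" "b \<in> (\<lambda>v. v j) ` W"
      then obtain v w where *: "v \<in> W" "w \<in> W" "a = v j" "b = w j"
        by blast
      then have "a \<oplus> b = (v \<oplus>\<^bsub>?F\<^esub> w) j"
        using j by (simp add: free_module_simps)
      then show "a \<oplus> b \<in> (\<lambda>v. v j) ` W"
        using * WE(5) by blast
    next
      note WE = F.submoduleE[OF W]
      fix a b assume a: "a \<in> carrier R" and "b \<in> (\<lambda>v. v j) ` W"
      then obtain w where *: "w \<in> W" "b = w j"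
        by blast
      then have "a \<otimes> b = (a \<odot>\<^bsub>?F\<^esub> w) j"
        using j by (simp add: free_module_simps)
      then show "a \<otimes> b \<in> (\<lambda>v. v j) ` W"
        using * a WE(4) by blast
    qed
    obtain A where A: "A \<subseteq> carrier R" "finite A" "(\<lambda>v. v j) ` U = Idl A"
      using finetely_gen[OF coord[OF Suc.prems(2)]] by auto
    have "A \<subseteq> (\<lambda>v. v j) ` U"
      using genideal_self[OF A(1)] A(3) by simp
    then have "\<forall>a\<in>A. \<exists>v. v \<in> U \<and> v j = a"
      by blast
    then obtain w where w: "\<And>a. a \<in> A \<Longrightarrow> w a \<in> U" "\<And>a. a \<in> A \<Longrightarrow> w a j = a"
      by metis
    \<comment> \<open>The kernel of the last coordinate that can be nonzero on \<open>U\<close>; the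
      induction hypothesis provides its generators.\<close>
    define U' where "U' = {v \<in> U. v j = \<zero>}"
    have "submodule U' R ?F"
    proof (rule F.submoduleI_smult)
      show "\<zero>\<^bsub>?F\<^esub> \<in> U'"
        using F.submodule_zero[OF Suc.prems(2)] j by (simp add: U'_def free_module_simps)
      show "U' \<subseteq> carrier ?F"
        using U(1) by (auto simp: U'_def)
    next
      fix u v assume "u \<in> U'" "v \<in> U'"
      then show "u \<oplus>\<^bsub>?F\<^esub> v \<in> U'"
        using U(5)[of u v] j by (simp add: U'_def free_module_simps)
    next
      fix a v assume "a \<in> carrier R" "v \<in> U'"
      then show "a \<odot>\<^bsub>?F\<^esub> v \<in> U'"
        using U(4)[of a v] j by (simp add: U'_def free_module_simps)
    qed
    moreover have "v i = \<zero>" if "v \<in> U'" "j \<le> i" "i < k" for v i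
      using that Suc.prems(3)[of v i] by (cases "i = j") (auto simp: U'_def)
    ultimately obtain S where S: "finite S" "S \<subseteq> U'"
      and genS: "\<And>V. submodule V R ?F \<Longrightarrow> S \<subseteq> V \<Longrightarrow> U' \<subseteq> V"
      using Suc.IH[of U'] j by auto
    have "U \<subseteq> V" if V: "submodule V R ?F" and SV: "S \<union> w ` A \<subseteq> V" for V
    proof
      fix v assume v: "v \<in> U"
      have "submodule (U \<inter> V) R ?F"
        by (rule F.submoduleI_smult)
          (use U F.submoduleE[OF V] F.submodule_zero[OF V] F.submodule_zero[OF Suc.prems(2)] in auto)
      \<comment> \<open>The coordinate ideal of \<open>U \<inter> V\<close> contains
        \<open>A\<close>, hence every \<open>v j\<close>. So \<open>v\<close> agrees in coordinate
        \<open>j\<close> with some \<open>u\<close> in \<open>U \<inter> V\<close>, and the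
        difference lies in \<open>U'\<close>, which is contained in \<open>V\<close>.\<close>
      from coord[OF this] have "ideal ((\<lambda>v. v j) ` (U \<inter> V)) R" .
      moreover have "A \<subseteq> (\<lambda>v. v j) ` (U \<inter> V)"
      proof
        fix a assume "a \<in> A"
        then have "w a \<in> U \<inter> V" "a = w a j"
          using w SV by auto
        then show "a \<in> (\<lambda>v. v j) ` (U \<inter> V)"
          by blast
      qed
      ultimately have "Idl A \<subseteq> (\<lambda>v. v j) ` (U \<inter> V)"
        by (rule genideal_minimal)
      moreover have "v j \<in> Idl A"
        using v by (simp flip: A(3))
      ultimately obtain u where u: "u \<in> U" "u \<in> V" "v j = u j"
        by blast
      have uv: "u \<in> carrier ?F" "v \<in> carrier ?F"
        using u v U(1) by auto
      define t where "t = v \<ominus>\<^bsub>?F\<^esub> u"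
      have tF: "t \<in> carrier ?F"
        using uv by (simp add: t_def)
      have vut: "v = u \<oplus>\<^bsub>?F\<^esub> t"
        using uv by (simp add: t_def F.M.minus_eq F.M.add_uminus_cancel)
      have "u j \<oplus> t j = u j"
        using fun_cong[OF vut, of j] u(3) j by (simp add: free_module_simps)
      then have "t j = \<zero>"
        using app[OF uv(1)] app[OF tF] by simp
      moreover have "t \<in> U"
        unfolding t_def by (rule F.submodule_minus[OF Suc.prems(2) v u(1)])
      ultimately have "t \<in> V"
        using genS[OF V] SV by (auto simp: U'_def)
      then show "v \<in> V"
        using vut u F.submoduleE(5)[OF V] by simp
    qed
    then show ?case
      using S A(2) w by (intro exI[of _ "S \<union> w ` A"]) (auto simp: U'_def)
  qed
  from this[of k U] show ?thesis
    using assms(3) that by auto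
qed

text \<open>Cover \<open>M\<close> by a finite free module, then repeatedly cover the kernel of the
  latest map, which is finitely generated by \<open>free_module_noetherian\<close>.\<close>

lemma free_resolution_exists:
  assumes "cring R" "noetherian_ring R" "module R M" "fin_gen_module R M"
  shows "\<exists>k d e. free_resolution R M k d e"
proof -
  let ?F = "free_module R"
  have F: "module R (?F k)" for k
    by (rule free_module_is_module) fact
  interpret M: module R M by fact
  obtain S where S: "finite S" "S \<subseteq> carrier M" "submodule_span R M S = carrier M"
    using assms(4) by (auto simp: fin_gen_module_def)
  obtain k0 e where e: "e \<in> module_homs R (?F k0) M" "e ` carrier (?F k0) = carrier M"
    using free_module_cover[OF assms(3) M.carrier_is_submodule S(1,2)]
      submodule_span_least[of _ R M S] S(3) by metis
  have cover: "\<exists>l g. g \<in> module_homs R (?F l) (?F k) \<and> g ` carrier (?F l) = U"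
    if U: "submodule U R (?F k)" for U k
  proof -
    obtain S where "finite S" "S \<subseteq> U"
      "\<And>V. submodule V R (?F k) \<Longrightarrow> S \<subseteq> V \<Longrightarrow> U \<subseteq> V"
      using free_module_noetherian[OF assms(1,2) U] by blast
    then show ?thesis
      using free_module_cover[OF F U] by metis
  qed
  \<comment> \<open>A state \<open>(k, l, g)\<close> at stage \<open>n\<close> stands for the
    differential \<open>g\<close> from \<open>R^l\<close> to \<open>R^k\<close>. \<open>P\<close>
    anchors stage \<open>0\<close> at the kernel of \<open>e\<close>; \<open>Q\<close> makes
    consecutive differentials composable and exact.\<close>
  define P where "P = (\<lambda>n::nat. \<lambda>(k, l, g). g \<in> module_homs R (?F l) (?F k) \<and>
    (n = 0 \<longrightarrow> k = k0 \<and> g ` carrier (?F l) = a_kernel (?F k0) M e))"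
  define Q where "Q = (\<lambda>n::nat. \<lambda>(k, l, g) (k', l', g'). k' = l \<and>
    g' ` carrier (?F l') = a_kernel (?F l) (?F k) g)"
  have "\<exists>s. \<forall>n. P n (s n) \<and> Q n (s n) (s (Suc n))"
  proof (rule dependent_nat_choice)
    obtain l g where "g \<in> module_homs R (?F l) (?F k0)"
      "g ` carrier (?F l) = a_kernel (?F k0) M e"
      using cover[OF submodule_a_kernel[OF F assms(3) e(1)]] by blast
    then have "P 0 (k0, l, g)"
      by (simp add: P_def)
    then show "\<exists>s. P 0 s" ..
  next
    fix s n assume Ps: "P n s"
    obtain k l g where s: "s = (k, l, g)"
      by (cases s)
    then have "g \<in> module_homs R (?F l) (?F k)"
      using Ps by (simp add: P_def)
    then obtain l' g' where "g' \<in> module_homs R (?F l') (?F l)"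
      "g' ` carrier (?F l') = a_kernel (?F l) (?F k) g"
      using cover[OF submodule_a_kernel[OF F F]] by blast
    then have "P (Suc n) (l, l', g')" "Q n s (l, l', g')"
      by (simp_all add: P_def Q_def s)
    then show "\<exists>t. P (Suc n) t \<and> Q n s t"
      by blast
  qed
  then obtain s where s: "\<And>n. P n (s n)" "\<And>n. Q n (s n) (s (Suc n))"
    by blast
  define k where "k = (\<lambda>n. fst (s n))"
  define d where "d = (\<lambda>n. snd (snd (s n)))"
  \<comment> \<open>By \<open>Q\<close> the source rank at stage \<open>n\<close> is the target rank
    at stage \<open>Suc n\<close>, so one rank function describes all stages.\<close>
  have sn: "s n = (k n, k (Suc n), d n)" for n
    using s(2)[of n] by (auto simp: Q_def k_def d_def split: prod.splits)
  have "free_resolution R M k d e"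
    unfolding free_resolution_def
    using s e by (auto simp: P_def Q_def sn)
  then show ?thesis
    by blast
qed

subsection \<open>Acyclicity of the Hom complex\<close>

text \<open>The annihilator consists of the cosets of those \<open>a\<close> that carry
  \<open>M\<close> into \<open>(xs) M\<close>, so faithfulness says that the colon ideal of
  \<open>(xs) M\<close> lies in the ideal generated by \<open>xs\<close>. Most of the proof is
  independence of the representatives of both cosets.\<close>

lemma (in module) faithful_residue_module_iff:
  assumes xs: "set xs \<subseteq> carrier R"
  shows "faithful_module (R Quot Idl (set xs)) (residue_module R (Idl (set xs)) M) \<longleftrightarrow>
    (\<forall>a\<in>carrier R. (\<forall>m\<in>carrier M. a \<odot>\<^bsub>M\<^esub> m \<in> seq_smult R xs M) \<longrightarrow> a \<in> Idl (set xs))"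
proof -
  let ?I = "Idl (set xs)" and ?U = "seq_smult R xs M"
  interpret I: ideal ?I R
    by (rule genideal_ideal[OF xs])
  note U = seq_smult_submodule[OF xs]
  have smult: "(\<Union>b\<in>?I +> a. \<Union>m'\<in>?U +>\<^bsub>M\<^esub> m. ?U +>\<^bsub>M\<^esub> (b \<odot>\<^bsub>M\<^esub> m')) = ?U \<longleftrightarrow>
      a \<odot>\<^bsub>M\<^esub> m \<in> ?U" if a: "a \<in> carrier R" and m: "m \<in> carrier M" for a m
  proof
    assume "(\<Union>b\<in>?I +> a. \<Union>m'\<in>?U +>\<^bsub>M\<^esub> m. ?U +>\<^bsub>M\<^esub> (b \<odot>\<^bsub>M\<^esub> m')) = ?U"
    then have "(\<Union>b\<in>?I +> a. \<Union>m'\<in>?U +>\<^bsub>M\<^esub> m. ?U +>\<^bsub>M\<^esub> (b \<odot>\<^bsub>M\<^esub> m')) \<subseteq> ?U"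
      by (rule equalityD1)
    moreover have "a \<odot>\<^bsub>M\<^esub> m \<in> ?U +>\<^bsub>M\<^esub> (a \<odot>\<^bsub>M\<^esub> m)" "a \<in> ?I +> a" "m \<in> ?U +>\<^bsub>M\<^esub> m"
      using a m coset_self_mem[OF U] I.a_rcos_self by auto
    ultimately show "a \<odot>\<^bsub>M\<^esub> m \<in> ?U"
      by blast
  next
    assume am: "a \<odot>\<^bsub>M\<^esub> m \<in> ?U"
    have "(\<Union>m'\<in>?U +>\<^bsub>M\<^esub> m. ?U +>\<^bsub>M\<^esub> (b \<odot>\<^bsub>M\<^esub> m')) = ?U" if b: "b \<in> ?I +> a" for b
    proof -
      obtain i where i: "i \<in> ?I" "b = i \<oplus> a"
        using b unfolding a_r_coset_def' by blast
      have "i \<in> carrier R"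
        using i(1) by (rule I.a_Hcarr)
      then show ?thesis
        using i a m am seq_smult_memI[OF i(1) m] submoduleE(5)[OF U]
        by (subst Union_smult_coset_eq[OF U]) (auto simp: smult_l_distr)
    qed
    then show "(\<Union>b\<in>?I +> a. \<Union>m'\<in>?U +>\<^bsub>M\<^esub> m. ?U +>\<^bsub>M\<^esub> (b \<odot>\<^bsub>M\<^esub> m')) = ?U"
      using I.a_rcos_self[OF a] by blast
  qed
  have coset: "?I +> a = ?I \<longleftrightarrow> a \<in> ?I" if "a \<in> carrier R" for a
    using I.a_rcos_self[OF that] I.a_rcos_const by blast
  have "(\<forall>m\<in>carrier (residue_module R ?I M). (?I +> a) \<odot>\<^bsub>residue_module R ?I M\<^esub> m =
      \<zero>\<^bsub>residue_module R ?I M\<^esub>) \<longleftrightarrow> (\<forall>m\<in>carrier M. a \<odot>\<^bsub>M\<^esub> m \<in> ?U)"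
    if "a \<in> carrier R" for a
    using that by (simp add: residue_module_def A_RCOSETS_def' smult)
  moreover have "carrier (R Quot ?I) = (\<lambda>a. ?I +> a) ` carrier R"
    by (auto simp: FactRing_def A_RCOSETS_def')
  ultimately have "annihilator (R Quot ?I) (residue_module R ?I M) =
    (\<lambda>a. ?I +> a) ` {a \<in> carrier R. \<forall>m\<in>carrier M. a \<odot>\<^bsub>M\<^esub> m \<in> ?U}"
    unfolding annihilator_def by auto
  \<comment> \<open>The zero coset always annihilates, so equality with the zero ideal reduces to an
    inclusion.\<close>
  moreover have "?I \<in> (\<lambda>a. ?I +> a) ` {a \<in> carrier R. \<forall>m\<in>carrier M. a \<odot>\<^bsub>M\<^esub> m \<in> ?U}"
    using coset[of \<zero>] submodule_zero[OF U] by (intro image_eqI[of _ _ \<zero>]) auto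
  moreover have "\<zero>\<^bsub>R Quot ?I\<^esub> = ?I"
    by (simp add: FactRing_def)
  ultimately have "faithful_module (R Quot ?I) (residue_module R ?I M) \<longleftrightarrow>
    (\<lambda>a. ?I +> a) ` {a \<in> carrier R. \<forall>m\<in>carrier M. a \<odot>\<^bsub>M\<^esub> m \<in> ?U} \<subseteq> {?I}"
    unfolding faithful_module_def by auto
  then show ?thesis
    using coset by (simp add: image_subset_iff) blast
qed

text \<open>Contravariance of \<open>Hom(-, N)\<close>, used for the differentials and for the
  augmentation. The map is restricted to the carrier because members of \<open>module_homs\<close>
  are extensional.\<close>

lemma precompose_module_hom:
  assumes "module R L" "module R M" "module R N" "h \<in> module_homs R L M"
  shows "(\<lambda>f\<in>carrier (Hom_module R M N). compose (carrier L) f h)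
    \<in> module_homs R (Hom_module R M N) (Hom_module R L N)" (is "?h \<in> _")
proof -
  interpret H: module R "Hom_module R M N"
    by (rule Hom_module_is_module) fact+
  show ?thesis
  proof (rule module_homsI)
    fix f assume "f \<in> carrier (Hom_module R M N)"
    then show "?h f \<in> carrier (Hom_module R L N)"
      using module_homs_compose[OF assms(1,2,4)] by (simp add: Hom_module_simps)
  next
    fix f g assume "f \<in> carrier (Hom_module R M N)" "g \<in> carrier (Hom_module R M N)"
    then show "?h (f \<oplus>\<^bsub>Hom_module R M N\<^esub> g) = ?h f \<oplus>\<^bsub>Hom_module R L N\<^esub> ?h g"
      using H.M.a_closed[of f g] module_homsD(1)[OF assms(4)]
      by (simp add: Hom_module_simps(3) compose_def cong: restrict_cong)
  next
    fix a f assume "a \<in> carrier R" "f \<in> carrier (Hom_module R M N)"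
    then show "?h (a \<odot>\<^bsub>Hom_module R M N\<^esub> f) = a \<odot>\<^bsub>Hom_module R L N\<^esub> ?h f"
      using H.smult_closed[of a f] module_homsD(1)[OF assms(4)]
      by (simp add: Hom_module_simps(4) compose_def cong: restrict_cong)
  qed auto
qed

text \<open>A nonzerodivisor on \<open>L\<close> stays one on \<open>U\<close>. This is confined to
  length one: a second member would act on \<open>U / x U\<close>, which need not embed in
  \<open>L / x L\<close>.\<close>

lemma regular_sequence_singleton_submodule:
  assumes "module R L" "submodule U R L" "regular_sequence R L [x]"
  shows "regular_sequence R (L\<lparr>carrier := U\<rparr>) [x]"
proof -
  interpret L: module R L by fact
  interpret U: module R "L\<lparr>carrier := U\<rparr>"
    by (rule submodule.submodule_is_module) fact+
  show ?thesis
    using assms(3) L.submoduleE(1)[OF assms(2)]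
      L.regular_sequence_snoc[of "[]" x] U.regular_sequence_snoc[of "[]" x]
    by (auto simp: L.seq_smult_empty U.seq_smult_empty U.regular_sequence_Nil)
qed

lemma module_homs_image:
  "f \<in> module_homs R M N \<Longrightarrow> f \<in> module_homs R M (N\<lparr>carrier := f ` carrier M\<rparr>)"
  by (auto simp: module_homs_def PiE_def)

lemma inclusion_module_hom:
  assumes "module R L" "submodule U R L"
  shows "(\<lambda>u\<in>U. u) \<in> module_homs R (L\<lparr>carrier := U\<rparr>) L"
proof -
  interpret L: module R L by fact
  show ?thesis
    by (rule module_homsI) (use L.submoduleE[OF assms(2)] in auto)
qed

text \<open>Exactness cuts the complex into short exact sequences with middle term
  \<open>C (Suc i)\<close>, kernel the image of \<open>D i\<close> and quotient the image of
  \<open>D (Suc i)\<close>. Descending through them gains one regular member at each step.\<close>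

lemma exact_complex_regular_image:
  assumes C: "\<And>i. module R (C i)" and D: "\<And>i. D i \<in> module_homs R (C i) (C (Suc i))"
    and exact: "\<And>i. Suc i < length xs \<Longrightarrow>
      a_kernel (C (Suc i)) (C (Suc (Suc i))) (D (Suc i)) = D i ` carrier (C i)"
    and reg: "\<And>i. regular_sequence R (C i) xs" and "xs \<noteq> []"
  shows "regular_sequence R (C (Suc 0)\<lparr>carrier := D 0 ` carrier (C 0)\<rparr>) xs"
proof -
  define B where "B = (\<lambda>i. C (Suc i)\<lparr>carrier := D i ` carrier (C i)\<rparr>)"
  have sub: "submodule (D i ` carrier (C i)) R (C (Suc i))" for i
    by (rule submodule_image[OF C C D module.carrier_is_submodule[OF C]])
  have B: "module R (B i)" for i
    unfolding B_def by (rule submodule.submodule_is_module[OF sub C])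
  \<comment> \<open>On \<open>B i\<close> the first \<open>length xs - i\<close> members are
    regular. The base \<open>t = 0\<close> is the last image, with one member; \<open>i = 0\<close>
    gives the whole sequence.\<close>
  have "regular_sequence R (B i) (take (Suc t) xs)" if "Suc (i + t) = length xs" for i t
    using that
  proof (induction t arbitrary: i)
    case 0
    have "take (Suc 0) xs = [hd xs]"
      using \<open>xs \<noteq> []\<close> by (cases xs) auto
    then show ?case
      using regular_sequence_take[OF reg, of "Suc i" "Suc 0"]
      by (auto simp: B_def intro: regular_sequence_singleton_submodule[OF C sub])
  next
    case (Suc t)
    have carr: "carrier (B i) = D i ` carrier (C i)"
      by (simp add: B_def)
    show ?case
    proof (rule exact_regular_sequence[OF B C B])
      show "(\<lambda>u\<in>carrier (B i). u) \<in> module_homs R (B i) (C (Suc i))"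
        unfolding carr unfolding B_def by (rule inclusion_module_hom[OF C sub])
      show "inj_on (\<lambda>u\<in>carrier (B i). u) (carrier (B i))"
        by (auto simp: inj_on_def)
      show "D (Suc i) \<in> module_homs R (C (Suc i)) (B (Suc i))"
        unfolding B_def by (rule module_homs_image[OF D])
      show "D (Suc i) ` carrier (C (Suc i)) = carrier (B (Suc i))"
        by (simp add: B_def)
      \<comment> \<open>Shrinking the target to \<open>B (Suc i)\<close> keeps its zero, and hence
        the kernel.\<close>
      have "a_kernel (C (Suc i)) (B (Suc i)) (D (Suc i)) = D i ` carrier (C i)"
        using exact[of i] Suc.prems by (simp add: B_def a_kernel_def')
      then show "(\<lambda>u\<in>carrier (B i). u) ` carrier (B i) = a_kernel (C (Suc i)) (B (Suc i)) (D (Suc i))"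
        by (simp add: carr)
      show "regular_sequence R (C (Suc i)) (take (Suc (Suc t)) xs)"
        by (rule regular_sequence_take[OF reg])
      show "regular_sequence R (B (Suc i)) (butlast (take (Suc (Suc t)) xs))"
        using Suc.IH[of "Suc i"] Suc.prems by (simp add: butlast_take)
    qed
  qed
  from this[of 0 "length xs - 1"] show ?thesis
    using \<open>xs \<noteq> []\<close> by (simp add: B_def)
qed

text \<open>The choice made in \<open>Ext_module\<close> depends only on \<open>R\<close> and
  \<open>M\<close>, so one resolution serves all degrees.\<close>

lemma Ext_module_free_resolution:
  assumes "\<exists>k d e. free_resolution R M k d e"
  obtains k d e where "free_resolution R M k d e"
    and "\<And>i. Ext_module R i M N = hom_cohomology R k d N i"
proof -
  define p where "p = (SOME (k, d, e). free_resolution R M k d e)"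
  have "case p of (k, d, e) \<Rightarrow> free_resolution R M k d e"
    unfolding p_def by (rule someI_ex) (use assms in auto)
  then show ?thesis
    using that by (cases p) (auto simp: Ext_module_def simp flip: p_def)
qed

text \<open>Cohomology classes are cosets in the module of cocycles. Cosets depend only on the
  addition, so they may be computed in the full cochain module.\<close>

lemma a_r_coset_carrier_update: "a_r_coset (G\<lparr>carrier := Z\<rparr>) H = a_r_coset G H"
  by (intro ext) (simp add: a_r_coset_def')

text \<open>If the only class is zero, each cocycle lies in the coset of the coboundaries.
  Conversely coboundaries are cocycles because consecutive maps of the resolution compose to
  zero.\<close>

lemma hom_cohomology_zero_exact:
  assumes "module R N" and "free_resolution R M k d e"
    and zero: "carrier (hom_cohomology R k d N (Suc i)) = {\<zero>\<^bsub>hom_cohomology R k d N (Suc i)\<^esub>}"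
  shows "a_kernel (hom_cochains R k N (Suc i)) (hom_cochains R k N (Suc (Suc i)))
      (hom_differential R k d (Suc i)) =
    hom_differential R k d i ` carrier (hom_cochains R k N i)" (is "?Z = ?B")
proof -
  interpret N: module R N by fact
  have F: "module R (free_module R l)" for l
    by (rule free_module_is_module) (rule N.is_cring)
  have d: "d j \<in> module_homs R (free_module R (k (Suc j))) (free_module R (k j))" for j
    using assms(2) by (simp add: free_resolution_def)
  have C: "module R (hom_cochains R k N j)" for j
    unfolding hom_cochains_def by (rule Hom_module_is_module[OF F assms(1)])
  interpret C: module R "hom_cochains R k N (Suc i)"
    by (rule C)
  \<comment> \<open>The restricted differential is the one known to lie in
    \<open>module_homs\<close>; it has the same image.\<close>
  have "(\<lambda>f\<in>carrier (hom_cochains R k N i). hom_differential R k d i f) `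
      carrier (hom_cochains R k N i) = ?B"
    by (rule image_restrict_eq)
  moreover have "submodule ((\<lambda>f\<in>carrier (hom_cochains R k N i). hom_differential R k d i f) `
      carrier (hom_cochains R k N i)) R (hom_cochains R k N (Suc i))"
    using precompose_module_hom[OF F F assms(1) d]
    by (intro submodule_image[OF C C _ module.carrier_is_submodule[OF C]])
      (simp add: hom_cochains_def hom_differential_def)
  ultimately have B: "submodule ?B R (hom_cochains R k N (Suc i))"
    by simp
  show ?thesis
  proof
    show "?Z \<subseteq> ?B"
    proof
      fix z assume z: "z \<in> ?Z"
      then have zC: "z \<in> carrier (hom_cochains R k N (Suc i))"
        by (simp add: a_kernel_def')
      have "(\<Union>x\<in>?Z. {?B +>\<^bsub>hom_cochains R k N (Suc i)\<^esub> x}) = {?B}"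
        using zero
        by (simp add: hom_cohomology_def quot_module_def A_RCOSETS_def' a_r_coset_carrier_update)
      then have "?B +>\<^bsub>hom_cochains R k N (Suc i)\<^esub> z = ?B"
        using z by blast
      then show "z \<in> ?B"
        using C.coset_eq_submodule[OF B zC] by simp
    qed
    show "?B \<subseteq> ?Z"
    proof
      fix z assume "z \<in> ?B"
      then obtain f where f: "f \<in> module_homs R (free_module R (k i)) N"
        and z: "z = hom_differential R k d i f"
        by (auto simp: hom_cochains_def Hom_module_simps)
      have "d i (d (Suc i) v) = \<zero>\<^bsub>free_module R (k i)\<^esub>"
        if "v \<in> carrier (free_module R (k (Suc (Suc i))))" for v
      proof -
        have "d (Suc i) v \<in> a_kernel (free_module R (k (Suc i))) (free_module R (k i)) (d i)"
          using assms(2) that by (simp add: free_resolution_def)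
        then show ?thesis
          by (simp add: a_kernel_def')
      qed
      then have "hom_differential R k d (Suc i) z = \<zero>\<^bsub>hom_cochains R k N (Suc (Suc i))\<^esub>"
        using module_homsD(1)[OF d[of "Suc i"]] module_homs_zero[OF F assms(1) f]
        by (simp add: z hom_differential_def hom_cochains_def Hom_module_simps compose_def
            cong: restrict_cong)
      moreover have "z \<in> carrier (hom_cochains R k N (Suc i))"
        using C.submoduleE(1)[OF B] \<open>z \<in> ?B\<close> by blast
      ultimately show "z \<in> ?Z"
        by (simp add: a_kernel_def')
    qed
  qed
qed

text \<open>A map that vanishes after \<open>d 0\<close> vanishes on the kernel of \<open>e\<close>
  and so factors through \<open>e\<close>; the factorization is unique because \<open>e\<close> is
  surjective.\<close>

lemma Hom_module_left_exact:
  assumes "module R N" "module R M" and "free_resolution R M k d e"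
  shows "(\<lambda>f\<in>module_homs R M N. compose (carrier (free_module R (k 0))) f e) ` module_homs R M N =
      a_kernel (hom_cochains R k N 0) (hom_cochains R k N (Suc 0)) (hom_differential R k d 0)"
    and "inj_on (\<lambda>f\<in>module_homs R M N. compose (carrier (free_module R (k 0))) f e) (module_homs R M N)"
proof -
  interpret N: module R N by fact
  have F: "module R (free_module R l)" for l
    by (rule free_module_is_module) (rule N.is_cring)
  interpret F0: module R "free_module R (k 0)"
    by (rule F)
  interpret M: module R M by fact
  let ?F = "carrier (free_module R (k 0))"
  have e: "e \<in> module_homs R (free_module R (k 0)) M" and surj: "e ` ?F = carrier M"
    and d: "d 0 \<in> module_homs R (free_module R (k (Suc 0))) (free_module R (k 0))"
    and ker: "a_kernel (free_module R (k 0)) M e = d 0 ` carrier (free_module R (k (Suc 0)))"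
    using assms(3) by (simp_all add: free_resolution_def)
  show "inj_on (\<lambda>f\<in>module_homs R M N. compose ?F f e) (module_homs R M N)"
  proof (rule inj_onI)
    fix f g assume fg: "f \<in> module_homs R M N" "g \<in> module_homs R M N"
      and "(\<lambda>f\<in>module_homs R M N. compose ?F f e) f = (\<lambda>f\<in>module_homs R M N. compose ?F f e) g"
    then have "compose ?F f e v = compose ?F g e v" for v
      by simp
    then have "f (e v) = g (e v)" if "v \<in> ?F" for v
      using that by (metis compose_eq)
    then show "f = g"
      using surj by (intro module_homs_eqI[OF fg]) (metis imageE)
  qed
  show "(\<lambda>f\<in>module_homs R M N. compose ?F f e) ` module_homs R M N =
      a_kernel (hom_cochains R k N 0) (hom_cochains R k N (Suc 0)) (hom_differential R k d 0)"
    (is "?L = ?Z")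
  proof
    show "?L \<subseteq> ?Z"
    proof
      fix z assume "z \<in> ?L"
      then obtain f where f: "f \<in> module_homs R M N" and z: "z = compose ?F f e"
        by auto
      have "e (d 0 v) = \<zero>\<^bsub>M\<^esub>" if "v \<in> carrier (free_module R (k (Suc 0)))" for v
      proof -
        have "d 0 v \<in> a_kernel (free_module R (k 0)) M e"
          using ker that by simp
        then show ?thesis
          by (simp add: a_kernel_def')
      qed
      then have "hom_differential R k d 0 z = \<zero>\<^bsub>hom_cochains R k N (Suc 0)\<^esub>"
        using module_homsD(1)[OF d] module_homs_zero[OF assms(2,1) f]
        by (simp add: z hom_differential_def hom_cochains_def Hom_module_simps compose_def
            cong: restrict_cong)
      moreover have "z \<in> carrier (hom_cochains R k N 0)"
        using module_homs_compose[OF F assms(2) e f] by (simp add: z hom_cochains_def Hom_module_simps)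
      ultimately show "z \<in> ?Z"
        by (simp add: a_kernel_def')
    qed
    show "?Z \<subseteq> ?L"
    proof
      fix z assume "z \<in> ?Z"
      then have z: "z \<in> module_homs R (free_module R (k 0)) N"
        and dz0: "hom_differential R k d 0 z = \<zero>\<^bsub>hom_cochains R k N (Suc 0)\<^esub>"
        by (simp_all add: a_kernel_def' hom_cochains_def Hom_module_simps)
      have dz: "z (d 0 v) = \<zero>\<^bsub>N\<^esub>" if "v \<in> carrier (free_module R (k (Suc 0)))" for v
        using that fun_cong[OF dz0, of v]
        by (simp add: hom_differential_def hom_cochains_def Hom_module_simps compose_eq)
      \<comment> \<open>\<open>z\<close> is constant on the fibres of \<open>e\<close>, since it
        kills the kernel of \<open>e\<close>, which is the image of \<open>d 0\<close>.\<close>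
      have zE: "z v = z w" if vw: "v \<in> ?F" "w \<in> ?F" "e v = e w" for v w
      proof -
        have "v \<ominus>\<^bsub>free_module R (k 0)\<^esub> w \<in> a_kernel (free_module R (k 0)) M e"
          using vw module_homsD(1)[OF e]
          by (simp add: a_kernel_def' module_homs_minus[OF F assms(2) e] M.M.minus_eq M.M.r_neg)
        then have "z (v \<ominus>\<^bsub>free_module R (k 0)\<^esub> w) = \<zero>\<^bsub>N\<^esub>"
          using ker dz by auto
        then show ?thesis
          using vw module_homsD(1)[OF z] N.M.add_uminus_cancel[of "z w" "z v"]
          by (simp add: module_homs_minus[OF F assms(1) z] N.M.minus_eq)
      qed
      \<comment> \<open>A set-theoretic section of \<open>e\<close>. Composing it with
        \<open>z\<close> gives \<open>f\<close>; linearity of \<open>f\<close> comes from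
        \<open>f (e v) = z v\<close>, not from \<open>s\<close>.\<close>
      define s where "s = (\<lambda>u. SOME v. v \<in> ?F \<and> e v = u)"
      have s: "s u \<in> ?F" "e (s u) = u" if "u \<in> carrier M" for u
      proof -
        have "\<exists>v. v \<in> ?F \<and> e v = u"
          using that unfolding surj[symmetric] by auto
        then have "s u \<in> ?F \<and> e (s u) = u"
          unfolding s_def by (rule someI_ex)
        then show "s u \<in> ?F" "e (s u) = u"
          by auto
      qed
      define f where "f = (\<lambda>u\<in>carrier M. z (s u))"
      have fe: "f (e v) = z v" if "v \<in> ?F" for v
        using that s[of "e v"] module_homsD(1)[OF e] by (auto simp: f_def intro: zE)
      have f: "f \<in> module_homs R M N"
      proof (rule module_homsI)
        fix u v assume uv: "u \<in> carrier M" "v \<in> carrier M"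
        then have "f (e (s u \<oplus>\<^bsub>free_module R (k 0)\<^esub> s v)) = f u \<oplus>\<^bsub>N\<^esub> f v"
          by (subst fe) (simp_all add: s f_def module_homsD[OF z])
        then show "f (u \<oplus>\<^bsub>M\<^esub> v) = f u \<oplus>\<^bsub>N\<^esub> f v"
          using uv by (simp add: s module_homsD[OF e])
      next
        fix a u assume au: "a \<in> carrier R" "u \<in> carrier M"
        then have "f (e (a \<odot>\<^bsub>free_module R (k 0)\<^esub> s u)) = a \<odot>\<^bsub>N\<^esub> f u"
          by (subst fe) (simp_all add: s f_def module_homsD[OF z])
        then show "f (a \<odot>\<^bsub>M\<^esub> u) = a \<odot>\<^bsub>N\<^esub> f u"
          using au by (simp add: s module_homsD[OF e])
      qed (auto simp: f_def s module_homsD[OF z])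
      have "z = compose ?F f e"
        using module_homs_compose[OF F assms(2) e f]
        by (intro module_homs_eqI[OF z]) (auto simp: compose_eq fe)
      then show "z \<in> ?L"
        using f by force
    qed
  qed
qed

text \<open>Both conclusions come from the short exact sequence that embeds \<open>Hom(M, N)\<close>
  in the cochains of degree \<open>0\<close> with quotient \<open>?B\<close>, the image of the first
  differential. The sequence \<open>xs\<close> is regular on the middle term and on
  \<open>?B\<close>.\<close>

lemma Hom_module_residue:
  assumes "module R N" "module R M" "free_resolution R M k d e"
    and exact: "\<And>i. 1 \<le> i \<Longrightarrow> i < length xs \<Longrightarrow>
      carrier (hom_cohomology R k d N i) = {\<zero>\<^bsub>hom_cohomology R k d N i\<^esub>}"
    and reg: "regular_sequence R N xs" and "xs \<noteq> []"
  shows "regular_sequence R (Hom_module R M N) xs"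
    and "\<And>f. f \<in> module_homs R M N \<Longrightarrow> (\<And>u. u \<in> carrier M \<Longrightarrow> f u \<in> seq_smult R xs N) \<Longrightarrow>
      f \<in> seq_smult R xs (Hom_module R M N)"
proof -
  interpret N: module R N by fact
  have F: "module R (free_module R l)" for l
    by (rule free_module_is_module) (rule N.is_cring)
  have e: "e \<in> module_homs R (free_module R (k 0)) M"
    and d: "\<And>i. d i \<in> module_homs R (free_module R (k (Suc i))) (free_module R (k i))"
    using assms(3) by (simp_all add: free_resolution_def)
  let ?C = "hom_cochains R k N"
  define D where "D = (\<lambda>i. \<lambda>f\<in>carrier (?C i). hom_differential R k d i f)"
  define E where "E = (\<lambda>f\<in>module_homs R M N. compose (carrier (free_module R (k 0))) f e)"
  have C: "module R (?C i)" for i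
    unfolding hom_cochains_def by (rule Hom_module_is_module[OF F assms(1)])
  have D: "D i \<in> module_homs R (?C i) (?C (Suc i))" for i
    using precompose_module_hom[OF F F assms(1) d]
    by (simp add: D_def hom_cochains_def hom_differential_def)
  have kerD: "a_kernel (?C i) (?C (Suc i)) (D i) =
    a_kernel (?C i) (?C (Suc i)) (hom_differential R k d i)" for i
    by (auto simp: D_def a_kernel_def')
  have regC: "regular_sequence R (?C i) xs" for i
    unfolding hom_cochains_def by (rule Hom_free_module_regular_sequence[OF assms(1) reg])
  let ?B = "?C (Suc 0)\<lparr>carrier := D 0 ` carrier (?C 0)\<rparr>"
  \<comment> \<open>Exactness is obtained in degrees \<open>1\<close> to
    \<open>length xs - 1\<close>, the range of the vanishing cohomology.\<close>
  have "a_kernel (?C (Suc i)) (?C (Suc (Suc i))) (D (Suc i)) = D i ` carrier (?C i)"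
    if "Suc i < length xs" for i
    using hom_cohomology_zero_exact[OF assms(1,3) exact[of "Suc i"]] that
    by (simp add: kerD) (simp add: D_def)
  then have regB: "regular_sequence R ?B xs"
    using C D regC \<open>xs \<noteq> []\<close> by (intro exact_complex_regular_image[of R ?C D xs])
  have "submodule (D 0 ` carrier (?C 0)) R (?C (Suc 0))"
    by (rule submodule_image[OF C C D module.carrier_is_submodule[OF C]])
  then have B: "module R ?B"
    by (rule submodule.submodule_is_module) (rule C)
  have H: "module R (Hom_module R M N)"
    by (rule Hom_module_is_module) fact+
  have E: "E \<in> module_homs R (Hom_module R M N) (?C 0)"
    using precompose_module_hom[OF F assms(2,1) e]
    by (simp add: E_def hom_cochains_def Hom_module_simps)
  have inj: "inj_on E (carrier (Hom_module R M N))"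
    using Hom_module_left_exact(2)[OF assms(1-3)] by (simp add: E_def Hom_module_simps)
  have "a_kernel (?C 0) ?B (D 0) = a_kernel (?C 0) (?C (Suc 0)) (D 0)"
    by (simp add: a_kernel_def')
  then have img: "E ` carrier (Hom_module R M N) = a_kernel (?C 0) ?B (D 0)"
    using Hom_module_left_exact(1)[OF assms(1-3)] kerD by (simp add: E_def Hom_module_simps)
  have D0: "D 0 \<in> module_homs R (?C 0) ?B"
    by (rule module_homs_image[OF D])
  show "regular_sequence R (Hom_module R M N) xs"
  proof (rule exact_regular_sequence[OF H C B E inj img D0 _ regC])
    show "regular_sequence R ?B (butlast xs)"
      using regular_sequence_take[OF regB] by (simp add: butlast_conv_take)
  qed simp
  fix f assume f: "f \<in> module_homs R M N" and fu: "\<And>u. u \<in> carrier M \<Longrightarrow> f u \<in> seq_smult R xs N"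
  \<comment> \<open>The composite takes values in \<open>(xs) N\<close> on the unit vectors, so it
    is in \<open>(xs)\<close> times the cochains of degree \<open>0\<close>; regularity on
    \<open>?B\<close> then pulls this back to \<open>Hom(M, N)\<close>.\<close>
  have "compose (carrier (free_module R (k 0))) f e \<in> seq_smult R xs (?C 0)"
    unfolding hom_cochains_def
    by (rule Hom_free_module_seq_smult[OF assms(1) regular_sequence_set[OF reg]
          module_homs_compose[OF F assms(2) e f]])
      (simp add: compose_eq N.unit_vec_closed fu module_homsD[OF e])
  then show "f \<in> seq_smult R xs (Hom_module R M N)"
    using exact_seq_smult[OF H C B E inj img D0 _ regB, of f] f
    by (simp add: E_def Hom_module_simps)
qed

text \<open>A scalar that kills \<open>N\<close> kills every homomorphism into \<open>N\<close>.
  This settles \<open>n = 0\<close>.\<close>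

lemma faithful_Hom_module:
  assumes "module R M" "module R N" "faithful_module R (Hom_module R M N)"
  shows "faithful_module R N"
proof -
  interpret N: module R N by fact
  have "annihilator R N \<subseteq> annihilator R (Hom_module R M N)"
    by (auto simp: annihilator_def Hom_module_simps module_homsD intro!: restrict_ext)
  then show ?thesis
    using assms(3) by (auto simp: faithful_module_def annihilator_def)
qed

theorem proposition5p9:
  fixes R :: "('a, 'r) ring_scheme"
    and M :: "('a, 'm, 'x) module_scheme"
    and N :: "('a, 'n, 'y) module_scheme"
    and n :: nat
  assumes "cring R" and "noetherian_ring R"
    and "module R M" and "fin_gen_module R M"
    and "module R N" and "fin_gen_module R N"
    and "\<And>i. 1 \<le> i \<Longrightarrow> i \<le> n - 1 \<Longrightarrow>
           carrier (Ext_module R i M N) = {\<zero>\<^bsub>Ext_module R i M N\<^esub>}"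
  shows "(absolutely_residually_faithful n R (Hom_module R M N) \<longrightarrow>
            absolutely_residually_faithful n R N) \<and>
         (universally_residually_faithful n R (Hom_module R M N) \<longrightarrow>
            universally_residually_faithful n R N)"
proof (cases "n = 0")
  case True
  then show ?thesis
    using faithful_Hom_module[OF assms(3,5)]
    by (simp add: absolutely_residually_faithful_def universally_residually_faithful_def)
next
  case False
  interpret N: module R N by fact
  interpret H: module R "Hom_module R M N"
    by (rule Hom_module_is_module) fact+
  obtain k d e where res: "free_resolution R M k d e"
    and Ext: "\<And>i. Ext_module R i M N = hom_cohomology R k d N i"
    using Ext_module_free_resolution[OF free_resolution_exists[OF assms(1-4)]] by blast
  \<comment> \<open>Regularity on \<open>Hom(M, N)\<close> makes its residual faithfulness
    applicable to the same \<open>xs\<close>. In the universal case regularity on \<open>R\<close>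
    is carried over as it stands.\<close>
  have main: "regular_sequence R (Hom_module R M N) xs"
      "faithful_module (R Quot genideal R (set xs))
        (residue_module R (genideal R (set xs)) (Hom_module R M N)) \<Longrightarrow>
      faithful_module (R Quot genideal R (set xs)) (residue_module R (genideal R (set xs)) N)"
    if xs: "length xs = n" "regular_sequence R N xs" for xs
  proof -
    have ne: "xs \<noteq> []"
      using xs False by auto
    have coh: "carrier (hom_cohomology R k d N i) = {\<zero>\<^bsub>hom_cohomology R k d N i\<^esub>}"
      if "1 \<le> i" "i < length xs" for i
      using assms(7)[of i] that xs by (simp add: Ext)
    show "regular_sequence R (Hom_module R M N) xs"
      by (rule Hom_module_residue(1)[OF assms(5,3) res coh xs(2) ne])
    assume faithful: "faithful_module (R Quot genideal R (set xs))
        (residue_module R (genideal R (set xs)) (Hom_module R M N))"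
    show "faithful_module (R Quot genideal R (set xs)) (residue_module R (genideal R (set xs)) N)"
      unfolding N.faithful_residue_module_iff[OF regular_sequence_set[OF xs(2)]]
    proof (intro ballI impI)
      fix a assume a: "a \<in> carrier R" "\<forall>m\<in>carrier N. a \<odot>\<^bsub>N\<^esub> m \<in> seq_smult R xs N"
      \<comment> \<open>If \<open>a\<close> maps \<open>N\<close> into \<open>(xs) N\<close>, then
        \<open>a\<close> times \<open>f\<close> has all its values there, so it lies in
        \<open>(xs) Hom(M, N)\<close>.\<close>
      have "a \<odot>\<^bsub>Hom_module R M N\<^esub> f \<in> seq_smult R xs (Hom_module R M N)"
        if f: "f \<in> carrier (Hom_module R M N)" for f
      proof (rule Hom_module_residue(2)[OF assms(5,3) res coh xs(2) ne])
        show "a \<odot>\<^bsub>Hom_module R M N\<^esub> f \<in> module_homs R M N"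
          using H.smult_closed[OF a(1) f] by (simp add: Hom_module_simps(1))
        fix u assume "u \<in> carrier M"
        then show "(a \<odot>\<^bsub>Hom_module R M N\<^esub> f) u \<in> seq_smult R xs N"
          using a(2) f by (simp add: Hom_module_simps module_homsD)
      qed
      then show "a \<in> genideal R (set xs)"
        using faithful a(1)
        unfolding H.faithful_residue_module_iff[OF regular_sequence_set[OF xs(2)]] by blast
    qed
  qed
  show ?thesis
    using False main
    by (auto simp: absolutely_residually_faithful_def universally_residually_faithful_def)
qed

end
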